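(* Let $n,k$ be integers with $n>2$ and $1\le k<n$, and let $R_{n,k}$ be the radius of convergence of the Maclaurin series of $S_{n,k}$. Then: 1. $R_{n,1}=\varphi_{n,1}$; 2. for $k>1$, $R_{n,k}\le\left(\cos\frac{\pi}{n}+\sin\frac{\pi}{n}\cot\frac{(k-1)\pi}{n}\right)\varphi_{n,k}$; 3. for $k\ge\frac n2+1$, $R_{n,k}=\left(\cos\frac{\pi}{n}+\sin\frac{\pi}{n}\cot\frac{(k-1)\pi}{n}\right)\varphi_{n,k}$.
   Context: For integers $n>2$, $1\le k<n$ and $y\in[0,1]$ let $F_{n,k}(y)=\int_0^y(1-x^n)^{-k/n}\,dx$ and $\varphi_{n,k}=F_{n,k}(1)$ (finite). $S_{n,k}:[0,\varphi_{n,k}]\to[0,1]$ is the inverse function of $F_{n,k}$. It extends holomorphically to a neighborhood of $0$ in $\mathbb{C}$ (as the local inverse of the holomorphic function $z\mapsto\int_0^z(1-\zeta^n)^{-k/n}d\zeta$, $|z|<1$, principal branch); the Maclaurin series of $S_{n,k}$ is the Taylor series of this extension at $0$. *)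

theory Defs
  imports "HOL-Complex_Analysis.Complex_Analysis"
begin

(* At x = 1 the integrand takes the value 0 powr (- k/n) = 0; a single point does not affect
   the (improper, for y = 1) integral, which converges absolutely since k < n. *)
definition F_real :: "nat \<Rightarrow> nat \<Rightarrow> real \<Rightarrow> real" where
  "F_real n k y = integral {0..y} (\<lambda>x. (1 - x ^ n) powr (- (real k / real n)))"

definition phi :: "nat \<Rightarrow> nat \<Rightarrow> real" where
  "phi n k = F_real n k 1"

(* Meaningful on {0..phi n k} only. *)
definition S_real :: "nat \<Rightarrow> nat \<Rightarrow> real \<Rightarrow> real" where
  "S_real n k = the_inv_into {0..1} (F_real n k)"

(* Meaningful on the open unit disc only, where Re (1 - w ^ n) > 0, so that the principal
   branch used by powr is holomorphic along the segment. *)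
definition F_complex :: "nat \<Rightarrow> nat \<Rightarrow> complex \<Rightarrow> complex" where
  "F_complex n k z =
     contour_integral (linepath 0 z) (\<lambda>w. (1 - w ^ n) powr (- (of_nat k / of_nat n)))"

definition is_S_extension :: "nat \<Rightarrow> nat \<Rightarrow> (complex \<Rightarrow> complex) \<Rightarrow> bool" where
  "is_S_extension n k G \<longleftrightarrow>
     (\<exists>U V. open U \<and> 0 \<in> U \<and> U \<subseteq> ball 0 1 \<and> open V \<and> 0 \<in> V \<and>
            G holomorphic_on V \<and> homeomorphism U V (F_complex n k) G \<and>
            (\<forall>x\<in>{0..phi n k}. complex_of_real x \<in> V \<longrightarrow>
               G (complex_of_real x) = complex_of_real (S_real n k x)))"

(* Any two extensions agree near 0, so the Taylor series at 0 does not depend on the choice. *)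
definition S_extension :: "nat \<Rightarrow> nat \<Rightarrow> complex \<Rightarrow> complex" where
  "S_extension n k = (SOME G. is_S_extension n k G)"

definition maclaurin_S :: "nat \<Rightarrow> nat \<Rightarrow> complex fps" where
  "maclaurin_S n k = fps_expansion (S_extension n k) 0"

definition R_conv :: "nat \<Rightarrow> nat \<Rightarrow> ereal" where
  "R_conv n k = fps_conv_radius (maclaurin_S n k)"

end

theory Submission
  imports Defs
begin

text \<open>
  Let \<open>F\<close> be the primitive of \<open>(1 - z\<^sup>n)\<^sup>-\<^sup>k\<^sup>/\<^sup>n\<close> on the star domain \<open>D\<close>, the plane slit
  along the rays from the \<open>n\<close>-th roots of unity to infinity. By the reflection and rotation symmetries
  everything happens in the sector \<open>0 \<le> arg z \<le> \<pi>/n\<close>, which \<open>F\<close> maps onto a triangle with angles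
  \<open>\<pi>/n\<close> at \<open>0\<close> and \<open>\<pi> - k\<pi>/n\<close> at \<open>\<phi>\<close>; the third vertex, the image of infinity, has modulus
  \<open>T = \<phi> sin (k\<pi>/n) / sin ((k - 1)\<pi>/n)\<close>, which is the constant of the theorem. (For \<open>k = 1\<close> the
  triangle degenerates to a half-strip.) Since \<open>0 \<le> arg F' < k\<pi>/n\<close> on the sector, \<open>F\<close> is
  univalent on it, hence on \<open>D\<close>, and \<open>S\<close> extends holomorphically to \<open>F(D)\<close>. The same
  bound on \<open>arg F'\<close> makes suitable real parts of \<open>F\<close> monotone along lines, which shows that near
  the slits and near infinity \<open>F\<close> stays beyond the side of the triangle opposite to \<open>0\<close>, up to
  \<open>\<epsilon>\<close>. That side has distance \<open>\<phi>\<close> from \<open>0\<close> if \<open>k = 1\<close>, and distance \<open>T\<close> if \<open>k \<ge> n/2 + 1\<close>,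
  when the angle at the third vertex is not acute; the disc of that radius lies in \<open>F(D)\<close>.
  Conversely \<open>S\<close> is unbounded along the ray towards the third vertex, and for \<open>k = 1\<close> its second
  derivative is unbounded at \<open>\<phi>\<close>.
\<close>

section \<open>Unnormalised incomplete Beta integrals\<close>

definition inc_beta :: "real \<Rightarrow> real \<Rightarrow> real \<Rightarrow> real" where
  "inc_beta a b u = integral {0..u} (\<lambda>t. t powr (a - 1) * (1 - t) powr (b - 1))"

lemma inc_beta_0 [simp]: "inc_beta a b 0 = 0"
  by (simp add: inc_beta_def)

lemma inc_beta_1: "a > 0 \<Longrightarrow> b > 0 \<Longrightarrow> inc_beta a b 1 = Beta a b"
  unfolding inc_beta_def by (rule integral_unique) (rule has_integral_Beta_real)

lemma continuous_on_inc_beta: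
  assumes "a > 0" "b > 0"
  shows "continuous_on {0..1} (inc_beta a b)"
  unfolding inc_beta_def
  using assms has_integral_Beta_real indefinite_integral_continuous_1 by blast

lemma inc_beta_deriv:
  assumes "a > 0" "b > 0" "0 < u" "u < 1"
  shows "(inc_beta a b has_real_derivative u powr (a - 1) * (1 - u) powr (b - 1)) (at u)"
proof -
  let ?f = "\<lambda>t. t powr (a - 1) * (1 - t) powr (b - 1)"
  have "?f integrable_on {0..1}"
    using has_integral_Beta_real[OF assms(1,2)] by blast
  moreover have "continuous (at u within ({0..1} - {})) ?f"
    using assms by (intro continuous_intros) auto
  ultimately have "((\<lambda>v. integral {0..v} ?f) has_vector_derivative ?f u) (at u within ({0..1} - {}))"
    using assms by (intro integral_has_vector_derivative_continuous_at) auto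
  then show ?thesis
    using assms at_within_Icc_at[of 0 u 1]
    by (simp add: inc_beta_def[abs_def] has_real_derivative_iff_has_vector_derivative)
qed

section \<open>The integral along the real axis\<close>

locale exponents =
  fixes n k :: nat
  assumes n_gt_2: "n > 2" and k_ge_1: "1 \<le> k" and k_less_n: "k < n"
begin

definition p :: real where "p = real k / real n"

lemma p_pos: "0 < p" and p_less_1: "p < 1"
  using n_gt_2 k_ge_1 k_less_n by (auto simp: p_def)

lemma n_pos: "0 < n" using n_gt_2 by simp

text \<open>The substitution t = x^n turns \<open>F_real n k y\<close> into an incomplete Beta
  integral, which supplies continuity up to the singular endpoint y = 1 and the value there.\<close>

definition E :: "real \<Rightarrow> real" where
  "E y = inc_beta (1 / n) (1 - p) (y ^ n) / n"

lemma E_0 [simp]: "E 0 = 0"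
  using n_gt_2 by (simp add: E_def power_0_left)

lemma continuous_on_E: "continuous_on {0..1} E"
proof -
  have "continuous_on {0..1} (\<lambda>y::real. inc_beta (1 / n) (1 - p) (y ^ n))"
    by (rule continuous_on_compose2[OF continuous_on_inc_beta])
       (use n_pos p_less_1 in \<open>auto intro!: continuous_intros power_le_one\<close>)
  then show ?thesis unfolding E_def by (intro continuous_intros) (use n_pos in auto)
qed

text \<open>The factor \<open>n * y ^ (n - 1)\<close> from the chain rule for t = y^n cancels the
  power of t in the Beta integrand, up to the factor n.\<close>

lemma powr_aux:
  fixes y :: real
  assumes "y > 0"
  shows "(y ^ n) powr (1 / n - 1) * (n * y ^ (n - 1)) = n"
proof -
  have "(y ^ n) powr (1 / n - 1) = y powr (n * (1 / n - 1))"
    using assms n_pos by (simp only: powr_realpow[symmetric] powr_powr)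
  then have "(y ^ n) powr (1 / n - 1) = y powr (1 - real n)"
    using n_pos by (simp add: right_diff_distrib)
  moreover have "y ^ (n - 1) = y powr (real n - 1)"
    using assms n_pos by (simp add: powr_realpow[symmetric] of_nat_diff)
  moreover have "y powr (1 - real n) * y powr (real n - 1) = 1"
    using assms n_pos by (subst powr_add[symmetric]) (simp add: of_nat_diff)
  ultimately show ?thesis by simp
qed

lemma E_deriv:
  assumes "0 < y" "y < 1"
  shows "(E has_real_derivative (1 - y ^ n) powr (- p)) (at y)"
proof -
  have y: "0 < y ^ n" "y ^ n < 1" using assms n_pos by (auto intro: power_less_one_iff[THEN iffD2])
  have "((\<lambda>y. inc_beta (1 / n) (1 - p) (y ^ n)) has_real_derivative
      ((y ^ n) powr (1 / n - 1) * (1 - y ^ n) powr (1 - p - 1)) * (n * y ^ (n - 1))) (at y)"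
    by (rule DERIV_chain2[OF inc_beta_deriv])
       (use y n_pos p_less_1 in \<open>auto intro!: derivative_eq_intros\<close>)
  then have "(E has_real_derivative
      ((y ^ n) powr (1 / n - 1) * (1 - y ^ n) powr (1 - p - 1)) * (n * y ^ (n - 1)) / n) (at y)"
    unfolding E_def[abs_def] by (rule DERIV_cdivide)
  moreover have "((y ^ n) powr (1 / n - 1) * (1 - y ^ n) powr (1 - p - 1)) * (n * y ^ (n - 1)) / n
     = (1 - y ^ n) powr (- p)"
    using powr_aux[OF assms(1)] n_pos by (simp add: field_simps)
  ultimately show ?thesis by simp
qed

text \<open>The form of the fundamental theorem that asks for a derivative only in the interior is
  what fits: the integrand is unbounded near 1, and \<open>E_deriv\<close> leaves out both
  endpoints.\<close>

lemma E_has_integral: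
  assumes "0 \<le> y" "y \<le> 1"
  shows "((\<lambda>x. (1 - x ^ n) powr (- p)) has_integral E y) {0..y}"
proof -
  have "((\<lambda>x. (1 - x ^ n) powr (- p)) has_integral E y - E 0) {0..y}"
    by (rule fundamental_theorem_of_calculus_interior)
       (use assms in \<open>auto intro!: continuous_on_subset[OF continuous_on_E] E_deriv
          simp flip: has_real_derivative_iff_has_vector_derivative\<close>)
  then show ?thesis by simp
qed

lemma F_real_eq_E:
  assumes "0 \<le> y" "y \<le> 1"
  shows "F_real n k y = E y"
  using E_has_integral[OF assms] unfolding F_real_def p_def by (rule integral_unique)

lemma phi_eq_E: "phi n k = E 1"
  by (simp add: phi_def F_real_eq_E)

lemma phi_Beta: "phi n k = Beta (1 / n) (1 - p) / n"
  using n_pos p_less_1 by (simp add: phi_eq_E E_def inc_beta_1)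

lemma E_strict_mono:
  assumes "0 \<le> x" "x < y" "y \<le> 1"
  shows "E x < E y"
proof (rule DERIV_pos_imp_increasing_open[OF assms(2)])
  show "continuous_on {x..y} E"
    using assms by (intro continuous_on_subset[OF continuous_on_E]) auto
  fix t assume t: "x < t" "t < y"
  then have "0 < t" "t < 1" using assms by auto
  moreover from this have "t ^ n < 1" using n_pos by (simp add: power_less_one_iff)
  ultimately show "\<exists>d. (E has_real_derivative d) (at t) \<and> 0 < d"
    using E_deriv[of t] by (intro exI[of _ "(1 - t ^ n) powr (- p)"]) auto
qed

lemma phi_pos: "0 < phi n k"
  using E_strict_mono[of 0 1] by (simp add: phi_eq_E)

lemma E_tendsto_phi: "(E \<longlongrightarrow> phi n k) (at_left 1)"
  using continuous_on_E by (simp add: phi_eq_E continuous_on_Icc_at_leftD)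

section \<open>The side length \<open>T\<close> and the integral along the bisecting ray\<close>

text \<open>For k > 1 this is the integral of (1 + x^n)^(-p) over [0, infinity), see
  \<open>G_tendsto_T\<close>, that is, the distance from 0 to the image of infinity.\<close>

definition T :: real where
  "T = Beta (1 / n) ((real k - 1) / n) / n"

text \<open>The sine rule in the image triangle. With x = p - 1/n, Euler's reflection formula at x
  and at p turns the quotient of the two Beta values into a quotient of sines; the cotangent form
  comes from expanding sin (\<pi> x + \<pi>/n).\<close>

lemma T_phi:
  assumes "k > 1"
  shows "T * sin ((real k - 1) * pi / n) = phi n k * sin (real k * pi / n)"
    and "T = (cos (pi / n) + sin (pi / n) * cot ((real k - 1) * pi / n)) * phi n k"
proof -
  define x where "x = (real k - 1) / n"
  have x: "0 < x" "x < 1" "p = x + 1 / n" "0 < p" "p < 1"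
    using assms k_less_n n_pos p_pos p_less_1 by (auto simp: x_def p_def field_simps)
  have refl: "Gamma t * Gamma (1 - t) * sin (pi * t) = pi" if "0 < t" "t < 1" for t :: real
  proof -
    have "Gamma (complex_of_real t) * Gamma (complex_of_real (1 - t)) = of_real pi / sin (of_real (pi * t))"
      using Gamma_reflection_complex[of "of_real t"] by simp
    then have "complex_of_real (Gamma t * Gamma (1 - t)) = of_real (pi / sin (pi * t))"
      by (simp only: Gamma_complex_of_real of_real_mult of_real_divide sin_of_real[symmetric])
    then have "Gamma t * Gamma (1 - t) = pi / sin (pi * t)"
      by (simp only: of_real_eq_iff)
    moreover have "sin (pi * t) > 0" using that by (intro sin_gt_zero) auto
    ultimately show ?thesis by simp
  qed
  have "T * sin (pi * x) * n = Gamma (1 / n) * (Gamma x * sin (pi * x)) / Gamma p"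
    using n_pos x by (simp add: T_def Beta_def x_def[symmetric] add.commute)
  also have "\<dots> = Gamma (1 / n) * pi / (Gamma p * Gamma (1 - x))"
  proof -
    have "Gamma (1 - x) > 0" using x by (intro Gamma_real_pos) auto
    then have "Gamma x * sin (pi * x) = pi / Gamma (1 - x)"
      using refl[OF x(1,2)] by (simp add: eq_divide_eq mult_ac)
    then show ?thesis by simp
  qed
  also have "\<dots> = Gamma (1 / n) * (Gamma (1 - p) * sin (pi * p)) / Gamma (1 - x)"
  proof -
    have "Gamma p > 0" using x by (intro Gamma_real_pos) auto
    then have "Gamma (1 - p) * sin (pi * p) = pi / Gamma p"
      using refl[OF x(4,5)] by (simp add: eq_divide_eq mult_ac)
    then show ?thesis by simp
  qed
  also have "\<dots> = phi n k * sin (pi * p) * n"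
  proof -
    have e: "1 / n + (1 - p) = 1 - x" using x by simp
    show ?thesis
      using n_pos unfolding phi_Beta Beta_def e by simp
  qed
  finally have *: "T * sin (pi * x) = phi n k * sin (pi * p)" using n_pos by simp
  show "T * sin ((real k - 1) * pi / n) = phi n k * sin (real k * pi / n)"
    using * by (simp add: x_def p_def mult.commute)
  have s: "sin (pi * x) > 0" using x by (intro sin_gt_zero) auto
  have "sin (pi * p) = sin (pi * x) * cos (pi / n) + cos (pi * x) * sin (pi / n)"
    by (simp add: x(3) distrib_left sin_add)
  then have "T = (cos (pi / n) + sin (pi / n) * cot (pi * x)) * phi n k"
    using * s by (simp add: cot_def field_simps)
  then show "T = (cos (pi / n) + sin (pi / n) * cot ((real k - 1) * pi / n)) * phi n k"
    by (simp add: x_def mult.commute)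
qed

text \<open>The substitution \<open>t = y\<^sup>n / (1 + y\<^sup>n)\<close> turns the integral along the negative axis of
  \<open>z\<^sup>n\<close> into an incomplete Beta integral.\<close>

definition B :: "real \<Rightarrow> real" where
  "B y = inc_beta (1 / n) ((real k - 1) / n) (y ^ n / (1 + y ^ n)) / n"

lemma frac_bounds: "y > 0 \<Longrightarrow> 0 < y ^ n / (1 + y ^ n)" "y \<ge> 0 \<Longrightarrow> y ^ n / (1 + y ^ n) < (1::real)"
  "y \<ge> 0 \<Longrightarrow> 0 \<le> y ^ n / (1 + y ^ n)"
  by (auto intro!: divide_pos_pos add_pos_pos simp: divide_less_eq add_pos_nonneg)

lemma B_deriv:
  assumes "k > 1" "0 < y"
  shows "(B has_real_derivative (1 + y ^ n) powr (- p)) (at y)"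
proof -
  let ?v = "1 + y ^ n" and ?b = "(real k - 1) / n" and ?u = "y ^ n / (1 + y ^ n)"
  have v: "?v > 0" using assms by (simp add: add_pos_pos)
  have b: "?b > 0" using assms n_pos by simp
  have du: "((\<lambda>y. y ^ n / (1 + y ^ n)) has_real_derivative (n * y ^ (n - 1)) / ?v ^ 2) (at y)"
    using v by (auto intro!: derivative_eq_intros simp: power2_eq_square divide_simps) (auto simp: algebra_simps)
  have "((\<lambda>y. inc_beta (1 / n) ?b (y ^ n / (1 + y ^ n))) has_real_derivative
      (?u powr (1 / n - 1) * (1 - ?u) powr (?b - 1)) * ((n * y ^ (n - 1)) / ?v ^ 2)) (at y)"
    by (rule DERIV_chain2[OF inc_beta_deriv du]) (use frac_bounds[of y] assms n_pos b in auto)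
  then have "(B has_real_derivative
      (?u powr (1 / n - 1) * (1 - ?u) powr (?b - 1)) * ((n * y ^ (n - 1)) / ?v ^ 2) / n) (at y)"
    unfolding B_def[abs_def] by (rule DERIV_cdivide)
  moreover have "(?u powr (1 / n - 1) * (1 - ?u) powr (?b - 1)) * ((n * y ^ (n - 1)) / ?v ^ 2) / n
      = ?v powr (- p)"
  proof -
    have "1 - ?u = ?v powr (-1)" using v by (simp add: powr_minus field_simps)
    then have 1: "(1 - ?u) powr (?b - 1) = ?v powr (1 - ?b)" by (simp only: powr_powr) simp
    have 2: "?u powr (1 / n - 1) = (y ^ n) powr (1 / n - 1) * ?v powr (1 - 1 / n)"
      using v assms by (simp add: powr_divide powr_minus_divide[of ?v "1 - 1 / n", simplified])
    have 3: "1 / ?v ^ 2 = ?v powr (- 2)" using v by (simp add: powr_minus powr_numeral field_simps)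
    have e: "1 - 1 / n + (1 - ?b) + (- 2) = - p"
      using n_pos by (simp add: p_def field_simps)
    have "(?u powr (1 / n - 1) * (1 - ?u) powr (?b - 1)) * ((n * y ^ (n - 1)) / ?v ^ 2) / n
      = ((y ^ n) powr (1 / n - 1) * (n * y ^ (n - 1))) / n *
          (?v powr (1 - 1 / n) * ?v powr (1 - ?b) * (1 / ?v ^ 2))"
      unfolding 1 2 by simp
    also have "\<dots> = ?v powr (- p)"
      using powr_aux[OF assms(2)] n_pos e unfolding 3 by (simp only: powr_add[symmetric]) simp
    finally show ?thesis .
  qed
  ultimately show ?thesis by simp
qed

lemma continuous_on_B:
  assumes "k > 1"
  shows "continuous_on {0..} B"
proof -
  have b: "(real k - 1) / n > 0" "1 / real n > 0" using assms n_pos by simp_all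
  have "1 + y ^ n \<noteq> 0" if "y \<ge> 0" for y :: real
    using zero_le_power[OF that, of n] by linarith
  then have "continuous_on {0..} (\<lambda>y::real. y ^ n / (1 + y ^ n))"
    by (intro continuous_intros) auto
  then have "continuous_on {0..} (\<lambda>y::real. inc_beta (1 / n) ((real k - 1) / n) (y ^ n / (1 + y ^ n)))"
    by (rule continuous_on_compose2[OF continuous_on_inc_beta[OF b(2,1)]])
       (use frac_bounds in \<open>force simp: less_imp_le\<close>)
  then show ?thesis unfolding B_def using n_pos by (intro continuous_intros) auto
qed

lemma B_tendsto_T:
  assumes "k > 1"
  shows "(B \<longlongrightarrow> T) at_top"
proof -
  have b: "(real k - 1) / n > 0" "1 / real n > 0" using assms n_pos by simp_all
  have "filterlim (\<lambda>y::real. 1 + y ^ n) at_top at_top"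
    by (intro filterlim_tendsto_add_at_top[OF tendsto_const] filterlim_pow_at_top filterlim_ident n_pos)
  then have "((\<lambda>y::real. 1 - inverse (1 + y ^ n)) \<longlongrightarrow> 1 - 0) at_top"
    by (intro tendsto_intros tendsto_inverse_0_at_top)
  moreover have "\<forall>\<^sub>F y::real in at_top. 1 - inverse (1 + y ^ n) = y ^ n / (1 + y ^ n)"
    using eventually_ge_at_top[of 0]
  proof eventually_elim
    case (elim y)
    then have "1 + y ^ n > 0" using zero_le_power[OF elim, of n] by linarith
    then show ?case by (simp add: field_simps)
  qed
  ultimately have lim: "((\<lambda>y::real. y ^ n / (1 + y ^ n)) \<longlongrightarrow> 1) at_top"
    using tendsto_cong by force
  have "\<forall>\<^sub>F y::real in at_top. y ^ n / (1 + y ^ n) \<in> {0..1}"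
    using eventually_ge_at_top[of 0]
    by eventually_elim (use frac_bounds in \<open>force simp: less_imp_le\<close>)
  with lim have "((\<lambda>y::real. inc_beta (1 / n) ((real k - 1) / n) (y ^ n / (1 + y ^ n))) \<longlongrightarrow>
      inc_beta (1 / n) ((real k - 1) / n) 1) at_top"
    by (intro continuous_on_tendsto_compose[OF continuous_on_inc_beta[OF b(2,1)]]) auto
  then have "(B \<longlongrightarrow> inc_beta (1 / n) ((real k - 1) / n) 1 / n) at_top"
    unfolding B_def using n_pos by (intro tendsto_intros) auto
  then show ?thesis by (simp only: inc_beta_1[OF b(2,1)] T_def)
qed

text \<open>By \<open>F_ray\<close> this is the modulus of \<open>F\<close> at distance a along the
  bisecting ray. It is kept as an integral, apart from \<open>B\<close>, because it is also needed
  for k = 1, where the second Beta parameter of \<open>B\<close> is 0.\<close>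

definition G :: "real \<Rightarrow> real" where
  "G a = integral {0..a} (\<lambda>x. (1 + x ^ n) powr (- p))"

lemma one_plus_pow_pos: "x \<ge> 0 \<Longrightarrow> 1 + x ^ n > (0::real)"
  by (rule add_pos_nonneg) auto

lemma integrable_G: "(\<lambda>x. (1 + x ^ n) powr (- p)) integrable_on {0..a::real}"
proof (intro integrable_continuous_interval continuous_intros)
  show "\<forall>x\<in>{0..a}. 1 + x ^ n \<noteq> 0"
    using one_plus_pow_pos by (metis atLeastAtMost_iff less_irrefl)
qed

lemma G_has_integral: "((\<lambda>x. (1 + x ^ n) powr (- p)) has_integral G a) {0..a}"
  unfolding G_def using integrable_G by (rule integrable_integral)

lemma G_mono: "a \<le> b \<Longrightarrow> G a \<le> G b"
  unfolding G_def by (rule integral_subset_le) (auto intro: integrable_G)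

lemma G_nonneg: "0 \<le> G a"
  unfolding G_def by (rule integral_nonneg) (auto intro: integrable_G)

lemma G_pos:
  assumes "a > 0"
  shows "0 < G a"
proof -
  have "((\<lambda>x. (1 + a ^ n) powr (- p)) has_integral a * (1 + a ^ n) powr (- p)) {0..a}"
    using has_integral_const_real[of "(1 + a ^ n) powr (- p)" 0 a] assms by simp
  then have "a * (1 + a ^ n) powr (- p) \<le> G a"
    using G_has_integral[of a]
  proof (rule has_integral_le)
    fix x assume "x \<in> {0..a}"
    then show "(1 + a ^ n) powr (- p) \<le> (1 + x ^ n) powr (- p)"
      using p_pos one_plus_pow_pos[of x] by (intro powr_mono2') (auto intro: power_mono)
  qed
  moreover have "0 < a * (1 + a ^ n) powr (- p)"
    using assms one_plus_pow_pos[of a] by simp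
  ultimately show ?thesis by linarith
qed

lemma G_eq_B:
  assumes "k > 1" "0 \<le> a"
  shows "G a = B a"
proof -
  have "((\<lambda>x. (1 + x ^ n) powr (- p)) has_integral B a - B 0) {0..a}"
    by (rule fundamental_theorem_of_calculus_interior)
       (use assms in \<open>auto intro!: continuous_on_subset[OF continuous_on_B] B_deriv
          simp flip: has_real_derivative_iff_has_vector_derivative\<close>)
  moreover have "B 0 = 0" using n_pos by (simp add: B_def power_0_left)
  ultimately show ?thesis
    using has_integral_unique[OF G_has_integral[of a]] by (metis diff_zero)
qed

lemma G_tendsto_T:
  assumes "k > 1"
  shows "(G \<longlongrightarrow> T) at_top"
proof (rule Lim_transform_eventually[OF B_tendsto_T[OF assms]])
  show "\<forall>\<^sub>F a in at_top. B a = G a"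
    using eventually_ge_at_top[of 0] by eventually_elim (rule G_eq_B[OF assms, symmetric])
qed

lemma G_le_T:
  assumes "k > 1"
  shows "G a \<le> T"
proof (rule tendsto_lowerbound[OF G_tendsto_T[OF assms]])
  show "\<forall>\<^sub>F b in at_top. G a \<le> G b"
    using eventually_ge_at_top[of a] by eventually_elim (rule G_mono)
qed simp

text \<open>For p = 1/n the integrand is at least 1/(1 + x), so \<open>G\<close> grows at least like
  a logarithm: the triangle becomes a half-strip.\<close>

lemma G_at_top:
  assumes "k = 1"
  shows "filterlim G at_top at_top"
proof (rule filterlim_at_top_mono)
  have p1: "p = 1 / n" unfolding p_def using assms by simp
  show "filterlim (\<lambda>a::real. ln (1 + a)) at_top at_top"
    by (rule filterlim_compose[OF ln_at_top], rule filterlim_tendsto_add_at_top[OF tendsto_const filterlim_ident])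
  show "\<forall>\<^sub>F a in at_top. ln (1 + a) \<le> G a"
    using eventually_ge_at_top[of 0]
  proof eventually_elim
    case (elim a)
    have "((\<lambda>x. inverse (1 + x)) has_integral ln (1 + a) - ln (1 + 0)) {0..a}"
      by (rule fundamental_theorem_of_calculus)
         (use elim in \<open>auto intro!: derivative_eq_intros
            simp flip: has_real_derivative_iff_has_vector_derivative simp: inverse_eq_divide\<close>)
    then have "((\<lambda>x. inverse (1 + x)) has_integral ln (1 + a)) {0..a}" by simp
    then show ?case
      using G_has_integral
    proof (rule has_integral_le)
      fix x :: real assume "x \<in> {0..a}"
      then have x: "0 \<le> x" by simp
      \<comment> \<open>Keeping only the two extreme terms of the binomial sum gives 1 + x^n \<le>
        (1 + x)^n.\<close>
      have "(1 + x) ^ n = (\<Sum>i\<le>n. of_nat (n choose i) * 1 ^ i * x ^ (n - i))"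
        by (rule binomial_ring)
      also have "\<dots> \<ge> (\<Sum>i\<in>{0, n}. of_nat (n choose i) * 1 ^ i * x ^ (n - i))"
        by (rule sum_mono2) (use x in auto)
      finally have "1 + x ^ n \<le> (1 + x) ^ n"
        using n_gt_2 by simp
      then have "(1 + x ^ n) powr (1 / n) \<le> ((1 + x) powr n) powr (1 / n)"
        using x one_plus_pow_pos[OF x] by (intro powr_mono2) (auto simp: powr_realpow)
      then have "(1 + x ^ n) powr p \<le> 1 + x"
        using x n_pos p1 by (simp add: powr_powr)
      then show "inverse (1 + x) \<le> (1 + x ^ n) powr (- p)"
        using x one_plus_pow_pos[OF x] by (simp add: powr_minus le_imp_inverse_le)
    qed
  qed
qed

end

section \<open>The complex primitive on the slit plane\<close>

lemma Im_cis_mult: "Im (cis a * w) = sin a * Re w + cos a * Im w"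
  by (simp add: algebra_simps)

lemma Re_cis_mult: "Re (cis a * w) = cos a * Re w - sin a * Im w"
  by (simp add: algebra_simps)

context exponents begin

definition \<theta> :: real where "\<theta> = pi / n"

lemma \<theta>: "0 < \<theta>" "\<theta> \<le> pi / 3" "n * \<theta> = pi" "p * pi = k * \<theta>" "sin \<theta> > 0" "cos \<theta> > 0"
proof -
  show 1: "0 < \<theta>" "\<theta> \<le> pi / 3" "n * \<theta> = pi" "p * pi = k * \<theta>"
    using n_gt_2 by (auto simp: \<theta>_def p_def field_simps)
  show "sin \<theta> > 0" "cos \<theta> > 0"
    using 1 pi_gt_zero by (auto intro!: sin_gt_zero cos_gt_zero_pi)
qed

definition fn :: "complex \<Rightarrow> complex" where
  "fn w = (1 - w ^ n) powr (- (of_nat k / of_nat n))"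

definition D :: "complex set" where
  "D = {z. 1 - z ^ n \<notin> \<real>\<^sub>\<le>\<^sub>0}"

abbreviation F :: "complex \<Rightarrow> complex" where "F \<equiv> F_complex n k"

lemma fn_altdef: "fn w = (1 - w ^ n) powr of_real (- p)"
  by (simp add: fn_def p_def)

lemma in_D_iff: "z \<in> D \<longleftrightarrow> (Im (z ^ n) = 0 \<longrightarrow> Re (z ^ n) < 1)"
  by (auto simp: D_def complex_nonpos_Reals_iff)

lemma open_D: "open D"
proof -
  have "open ((\<lambda>z::complex. 1 - z ^ n) -` (- \<real>\<^sub>\<le>\<^sub>0))"
    by (intro open_vimage continuous_intros) (simp add: open_Compl)
  then show ?thesis by (simp add: D_def vimage_def)
qed

lemma zero_in_D [simp]: "0 \<in> D"
  using n_pos by (simp add: in_D_iff power_0_left)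

lemma scale_in_D:
  assumes "z \<in> D" "0 \<le> t" "t \<le> 1"
  shows "of_real t * z \<in> D"
proof -
  define s where "s = t ^ n"
  have eq: "(of_real t * z) ^ n = of_real s * z ^ n" by (simp add: power_mult_distrib s_def)
  have s: "0 \<le> s" "s \<le> 1" using assms by (auto simp: s_def intro: power_le_one)
  have "s * Re (z ^ n) < 1" if "s * Im (z ^ n) = 0"
  proof (cases "s = 0 \<or> Re (z ^ n) \<le> 0")
    case True
    then have "s * Re (z ^ n) \<le> 0" using s(1) by (auto simp: mult_nonneg_nonpos)
    then show ?thesis by linarith
  next
    case False
    with that assms have "Re (z ^ n) < 1" by (simp add: in_D_iff)
    with False s mult_left_le_one_le[of "Re (z ^ n)" s] show ?thesis by linarith
  qed
  then show ?thesis by (simp add: in_D_iff eq)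
qed

lemma segment_in_D:
  assumes "z \<in> D"
  shows "closed_segment 0 z \<subseteq> D"
  using scale_in_D[OF assms] by (auto simp: in_segment scaleR_conv_of_real)

lemma F_eq_integral: "F z = integral {0..1} (\<lambda>t. fn (of_real t * z)) * z"
  unfolding F_complex_def fn_def contour_integral_integral
  by (simp add: linepath_def scaleR_conv_of_real)

lemma F_0 [simp]: "F 0 = 0"
  by (simp add: F_eq_integral)

lemma fn_deriv:
  fixes z :: complex
  assumes "z \<in> D"
  shows "(fn has_field_derivative
    (of_real (- p) * (1 - z ^ n) powr (of_real (- p) - 1)) * - (n * z ^ (n - 1))) (at z)"
proof -
  have z: "1 - z ^ n \<notin> \<real>\<^sub>\<le>\<^sub>0" using assms by (simp add: D_def)
  show ?thesis unfolding fn_altdef[abs_def]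
    by (rule DERIV_chain2[where f = "\<lambda>z. z powr of_real (- p)" and g = "\<lambda>z. 1 - z ^ n",
          OF has_field_derivative_powr[OF z]]) (auto intro!: derivative_eq_intros)
qed

text \<open>\<open>D\<close> is starlike about 0, so \<open>fn\<close> has a primitive on it, and
  the segment integral that defines \<open>F\<close> differs from this primitive by a constant.
  Hence \<open>F\<close> is a primitive well beyond the unit disc.\<close>

lemma F_deriv:
  assumes "z \<in> D"
  shows "(F has_field_derivative fn z) (at z)"
proof -
  have "starlike D"
    unfolding starlike_def using segment_in_D zero_in_D by blast
  moreover have "continuous_on D fn"
    using fn_deriv by (meson DERIV_isCont continuous_at_imp_continuous_on)
  moreover have "fn field_differentiable at x" if "x \<in> D - {}" for x
    using fn_deriv that by (auto simp: field_differentiable_def)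
  ultimately obtain g where g: "\<And>x. x \<in> D \<Longrightarrow> (g has_field_derivative fn x) (at x)"
    using holomorphic_starlike_primitive[of D fn "{}"] open_D by auto
  have "F x = g x - g 0" if "x \<in> D" for x
  proof -
    have "(fn has_contour_integral (g (pathfinish (linepath 0 x)) - g (pathstart (linepath 0 x)))) (linepath 0 x)"
    proof (rule contour_integral_primitive)
      show "(g has_field_derivative fn y) (at y within D)" if "y \<in> D" for y
        using g[OF that] by (rule has_field_derivative_at_within)
      show "path_image (linepath 0 x) \<subseteq> D"
        unfolding path_image_linepath by (rule segment_in_D[OF that])
    qed (rule valid_path_linepath)
    then have "contour_integral (linepath 0 x) fn = g x - g 0"
      unfolding pathfinish_linepath pathstart_linepath by (rule contour_integral_unique)
    then show ?thesis
      unfolding F_complex_def fn_def[abs_def] .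
  qed
  then have eq: "g x - g 0 = F x" if "x \<in> D" for x using that by simp
  have "((\<lambda>x. g x - g 0) has_field_derivative fn z - 0) (at z)"
    by (intro DERIV_diff g assms DERIV_const)
  then have "((\<lambda>x. g x - g 0) has_field_derivative fn z) (at z)" by simp
  then show ?thesis
    using eq by (rule has_field_derivative_transform_within_open[OF _ open_D assms])
qed

lemma holomorphic_F: "F holomorphic_on D"
  using F_deriv open_D by (auto simp: holomorphic_on_open)

lemma continuous_on_F: "continuous_on D F"
  using holomorphic_F by (rule holomorphic_on_imp_continuous_on)

text \<open>\<open>fn\<close> depends on its argument only through the n-th power, which a root of
  unity leaves unchanged.\<close>

lemma F_rotate:
  assumes "\<omega> ^ n = 1"
  shows "F (\<omega> * z) = \<omega> * F z"
proof -
  have "fn (of_real t * (\<omega> * z)) = fn (of_real t * z)" for t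
    using assms by (simp add: fn_def power_mult_distrib)
  then show ?thesis by (simp add: F_eq_integral)
qed

text \<open>Conjugation commutes with the principal power off the cut, and the segment from 0 to a
  point of \<open>D\<close> keeps the base off the cut.\<close>

lemma F_cnj:
  assumes "z \<in> D"
  shows "F (cnj z) = cnj (F z)"
proof -
  have "fn (of_real t * cnj z) = cnj (fn (of_real t * z))" if t: "t \<in> {0..1}" for t
  proof -
    have "of_real t * z \<in> D" using scale_in_D[OF assms] t by simp
    then have "Im (1 - (of_real t * z) ^ n) = 0 \<Longrightarrow> Re (1 - (of_real t * z) ^ n) \<ge> 0"
      unfolding in_D_iff by simp
    from cnj_powr[OF this] show ?thesis unfolding fn_altdef by simp
  qed
  then have "integral {0..1} (\<lambda>t. fn (of_real t * cnj z)) = integral {0..1} (\<lambda>t. cnj (fn (of_real t * z)))"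
    by (rule integral_cong)
  then show ?thesis by (simp add: F_eq_integral integral_cnj)
qed

lemma cnj_in_D [simp]: "cnj z \<in> D \<longleftrightarrow> z \<in> D"
  by (simp add: in_D_iff flip: complex_cnj_power)

lemma of_real_in_D:
  assumes "0 \<le> x" "x < 1"
  shows "complex_of_real x \<in> D"
  using assms n_pos by (simp add: in_D_iff power_less_one_iff flip: of_real_power)

text \<open>With c = 1 and c = \<open>e\<close> this identifies \<open>F\<close> on the two sides of
  the sector with the real integrals \<open>E\<close> and \<open>G\<close>.\<close>

lemma F_has_integral_ray:
  assumes "0 \<le> y" "of_real y * c \<in> D"
  shows "((\<lambda>x. fn (of_real x * c) * c) has_integral F (of_real y * c)) {0..y}"
proof -
  have in_D: "of_real x * c \<in> D" if "x \<in> {0..y}" for x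
  proof (cases "y = 0")
    case True with that show ?thesis by simp
  next
    case False
    have "of_real (x / y) * (of_real y * c) \<in> D"
      using that assms False by (intro scale_in_D[OF assms(2), of "x / y"]) auto
    then show ?thesis using False by simp
  qed
  have "((\<lambda>x. fn (of_real x * c) * c) has_integral F (of_real y * c) - F (of_real 0 * c)) {0..y}"
  proof (rule fundamental_theorem_of_calculus)
    fix x assume x: "x \<in> {0..y}"
    have "((\<lambda>x. of_real x * c) has_vector_derivative c) (at x within {0..y})"
      using has_vector_derivative_mult_left[OF has_vector_derivative_of_real[OF DERIV_ident]]
      by simp
    from field_vector_diff_chain_within[OF this has_field_derivative_at_within[OF F_deriv[OF in_D[OF x]]]]
    show "((\<lambda>x. F (of_real x * c)) has_vector_derivative fn (of_real x * c) * c) (at x within {0..y})"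
      by (simp add: o_def mult.commute)
  qed (use assms in auto)
  then show ?thesis by simp
qed

lemma F_of_real:
  assumes "0 \<le> y" "y < 1"
  shows "F (of_real y) = of_real (E y)"
proof -
  have "((\<lambda>x. fn (of_real x * 1) * 1) has_integral F (of_real y * 1)) {0..y}"
    using assms of_real_in_D by (intro F_has_integral_ray) auto
  moreover have "((\<lambda>x. of_real ((1 - x ^ n) powr (- p))) has_integral complex_of_real (E y)) {0..y}"
    using E_has_integral[of y] assms by (intro has_integral_of_real) auto
  then have "((\<lambda>x. fn (of_real x * 1) * 1) has_integral complex_of_real (E y)) {0..y}"
  proof (rule has_integral_eq[rotated])
    fix x assume "x \<in> {0..y}"
    then have "0 \<le> 1 - x ^ n" using assms by (simp add: power_le_one)
    then have "complex_of_real (1 - x ^ n) powr of_real (- p) = of_real ((1 - x ^ n) powr (- p))"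
      by (rule powr_of_real)
    then show "complex_of_real ((1 - x ^ n) powr (- p)) = fn (of_real x * 1) * 1"
      unfolding fn_altdef by simp
  qed
  ultimately have "F (of_real y * 1) = complex_of_real (E y)" by (rule has_integral_unique)
  then show ?thesis by simp
qed

text \<open>The direction halfway between two neighbouring slits, where z^n is a negative
  real.\<close>

definition e :: complex where "e = cis \<theta>"

lemma e_pow_n: "e ^ n = -1"
  by (simp only: e_def Complex.DeMoivre \<theta>(3) cis_pi)

lemma ray_in_D: "0 \<le> a \<Longrightarrow> of_real a * e \<in> D"
proof -
  assume "0 \<le> a"
  then have "0 \<le> a ^ n" by simp
  then show ?thesis
    unfolding in_D_iff power_mult_distrib e_pow_n by (simp flip: of_real_power)
qed

lemma F_ray:
  assumes "0 \<le> a"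
  shows "F (of_real a * e) = of_real (G a) * e"
proof -
  have "((\<lambda>x. fn (of_real x * e) * e) has_integral F (of_real a * e)) {0..a}"
    using assms ray_in_D by (intro F_has_integral_ray) auto
  moreover have "((\<lambda>x. of_real ((1 + x ^ n) powr (- p)) * e) has_integral complex_of_real (G a) * e) {0..a}"
    by (intro has_integral_mult_left has_integral_of_real G_has_integral)
  then have "((\<lambda>x. fn (of_real x * e) * e) has_integral complex_of_real (G a) * e) {0..a}"
  proof (rule has_integral_eq[rotated])
    fix x assume "x \<in> {0..a}"
    then have "0 \<le> 1 + x ^ n" using one_plus_pow_pos[of x] by simp
    then have "complex_of_real (1 + x ^ n) powr of_real (- p) = of_real ((1 + x ^ n) powr (- p))"
      by (rule powr_of_real)
    then show "complex_of_real ((1 + x ^ n) powr (- p)) * e = fn (of_real x * e) * e"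
      unfolding fn_altdef power_mult_distrib e_pow_n by simp
  qed
  ultimately show ?thesis by (rule has_integral_unique)
qed

end

section \<open>The sector between a slit and the neighbouring bisecting ray\<close>

lemma rcis_cis_mult: "cis a * rcis r b = rcis r (a + b)"
  by (simp add: rcis_def cis_mult algebra_simps)

text \<open>Cramer's rule for the basis \<open>cis b\<close>, \<open>cis (- c)\<close>: after
  multiplication by \<open>cis c\<close> the imaginary part no longer sees the second basis vector,
  after multiplication by \<open>cis (- b)\<close> no longer the first.\<close>

lemma oblique_coordinates:
  assumes "sin (b + c) \<noteq> 0"
  shows "z = of_real (Im (cis c * z) / sin (b + c)) * cis b
           + of_real (- Im (cis (- b) * z) / sin (b + c)) * cis (- c)"
proof -
  have "of_real (sin (b + c)) * z = of_real (Im (cis c * z)) * cis b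
           + of_real (- Im (cis (- b) * z)) * cis (- c)"
    unfolding complex_eq_iff sin_add by (simp add: algebra_simps)
  then show ?thesis using assms
    by (simp add: field_simps del: times_complex.sel)
qed

context exponents begin

text \<open>The sector 0 \<le> arg z \<le> \<theta> as an intersection of two half-planes, which
  avoids the argument at 0 and makes closedness and convexity linear matters.\<close>

definition cone :: "complex set" where
  "cone = {z. 0 \<le> Im z \<and> Im (cis (- \<theta>) * z) \<le> 0}"

definition slit_cone :: "complex set" where
  "slit_cone = {z \<in> cone. Im z = 0 \<longrightarrow> Re z < 1}"

lemma cone_polar:
  assumes "z \<in> cone"
  obtains t where "0 \<le> t" "t \<le> \<theta>" "z = rcis (norm z) t"
proof (cases "z = 0")
  case True
  with that[of 0] \<theta> show ?thesis by simp
next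
  case False
  let ?t = "Arg z"
  have z: "z = rcis (norm z) ?t" by (simp add: rcis_cmod_Arg)
  have t: "- pi < ?t" "?t \<le> pi" using Arg_bounded by auto
  have "0 \<le> norm z * sin ?t" using assms z by (metis Im_rcis cone_def mem_Collect_eq)
  with False have "0 \<le> sin ?t" by (simp add: zero_le_mult_iff)
  with t have t0: "0 \<le> ?t" using sin_gt_zero[of "- ?t"] by fastforce
  have "cis (- \<theta>) * z = rcis (norm z) (?t - \<theta>)"
    by (subst z) (simp add: rcis_cis_mult)
  with assms have "norm z * sin (?t - \<theta>) \<le> 0" by (simp add: cone_def del: times_complex.sel)
  with False have *: "sin (?t - \<theta>) \<le> 0" by (simp add: mult_le_0_iff)
  have "?t \<le> \<theta>"
  proof (rule ccontr)
    assume "\<not> ?t \<le> \<theta>"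
    then have "sin (?t - \<theta>) > 0" using t \<theta> by (intro sin_gt_zero) auto
    with * show False by simp
  qed
  with t0 z that show ?thesis by blast
qed

lemma rcis_in_cone: "0 \<le> r \<Longrightarrow> 0 \<le> t \<Longrightarrow> t \<le> \<theta> \<Longrightarrow> rcis r t \<in> cone"
  using \<theta>(1,2) pi_gt_zero sin_ge_zero[of t] sin_ge_zero[of "\<theta> - t"] sin_minus[of "\<theta> - t"]
  by (auto simp: cone_def rcis_cis_mult mult_nonneg_nonpos simp del: times_complex.sel)

text \<open>For z of argument t in [0, \<theta>] the angle n t lies in [0, \<pi>], so z^n can meet
  [1, infinity) only for t = 0, on the real axis.\<close>

lemma slit_cone_iff: "z \<in> slit_cone \<longleftrightarrow> z \<in> cone \<and> z \<in> D"
proof (cases "z \<in> cone")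
  case True
  then obtain t where t: "0 \<le> t" "t \<le> \<theta>" "z = rcis (norm z) t" by (rule cone_polar)
  define r where "r = norm z"
  have zn: "z ^ n = rcis (r ^ n) (n * t)" using t(3) by (metis DeMoivre2 r_def)
  have nt: "0 \<le> n * t" "n * t \<le> pi" using t n_pos \<theta> mult_left_mono[OF t(2), of n] by auto
  show ?thesis
  proof (cases "t = 0")
    case True
    with t have z: "z = of_real r" by (simp add: r_def rcis_def)
    have "r \<ge> 0" by (simp add: r_def)
    then show ?thesis using \<open>z \<in> cone\<close> n_pos
      by (simp add: slit_cone_def in_D_iff z power_less_one_iff flip: of_real_power)
  next
    case False
    then have t0: "0 < t" using t by simp
    have "z \<in> D"
    proof -
      have "Re (z ^ n) < 1" if "Im (z ^ n) = 0"
      proof (cases "r = 0")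
        case True with zn n_pos show ?thesis by (simp add: power_0_left)
      next
        case False
        with that zn have "sin (n * t) = 0" by simp
        moreover have "n * t > 0" using t0 n_pos by simp
        ultimately have "n * t = pi" using nt(2) sin_gt_zero[of "n * t"] by linarith
        then have "Re (z ^ n) = - (r ^ n)" by (simp add: zn)
        moreover have "r ^ n \<ge> 0" by (simp add: r_def)
        ultimately show ?thesis by linarith
      qed
      then show ?thesis by (simp add: in_D_iff)
    qed
    moreover have "z \<in> slit_cone"
    proof -
      have "Re z < 1" if "Im z = 0"
      proof -
        have "sin t > 0" using t0 t \<theta> pi_gt_zero by (intro sin_gt_zero) auto
        moreover have "Im z = r * sin t" using t(3) by (metis Im_rcis r_def)
        ultimately have "r = 0" using that by simp
        then show ?thesis by (simp add: r_def)
      qed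
      then show ?thesis using \<open>z \<in> cone\<close> by (simp add: slit_cone_def)
    qed
    ultimately show ?thesis using \<open>z \<in> cone\<close> by simp
  qed
next
  case False
  then show ?thesis by (simp add: slit_cone_def)
qed

lemma cone_power_Im:
  assumes "z \<in> cone"
  shows "0 \<le> Im (z ^ n)"
proof -
  obtain t where t: "0 \<le> t" "t \<le> \<theta>" "z = rcis (norm z) t" using assms by (rule cone_polar)
  have "z ^ n = rcis (norm z ^ n) (n * t)" using t(3) by (metis DeMoivre2)
  moreover have "0 \<le> n * t" "n * t \<le> pi" using t n_pos \<theta> mult_left_mono[OF t(2), of n] by auto
  ultimately show ?thesis by (simp add: sin_ge_zero)
qed

text \<open>The removed slit lies on the boundary line Im z = 0. A convex combination on that line
  uses with positive weight only points of that line, all of them left of 1.\<close>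

lemma convex_slit_cone: "convex slit_cone"
proof (rule convexI)
  fix x y :: complex and u v :: real
  assume *: "x \<in> slit_cone" "y \<in> slit_cone" "0 \<le> u" "0 \<le> v" "u + v = 1"
  let ?w = "u *\<^sub>R x + v *\<^sub>R y"
  have "Im ?w \<ge> 0" using * by (simp add: slit_cone_def cone_def)
  moreover have "Im (cis (- \<theta>) * ?w) = u * Im (cis (- \<theta>) * x) + v * Im (cis (- \<theta>) * y)"
    by (simp add: algebra_simps)
  then have "Im (cis (- \<theta>) * ?w) \<le> 0"
    using * by (simp add: slit_cone_def cone_def add_nonpos_nonpos mult_nonneg_nonpos del: times_complex.sel)
  moreover have "Re ?w < 1" if "Im ?w = 0"
  proof -
    have nn: "0 \<le> u * Im x" "0 \<le> v * Im y" using * by (auto simp: slit_cone_def cone_def)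
    with that have z: "u * Im x = 0" "v * Im y = 0" by (simp_all add: add_nonneg_eq_0_iff)
    consider "u = 0" | "v = 0" | "u > 0" "v > 0" using * by force
    then show ?thesis
    proof cases
      case 1 with * that show ?thesis by (auto simp: slit_cone_def)
    next
      case 2 with * that show ?thesis by (auto simp: slit_cone_def)
    next
      case 3
      with z * have "Re x < 1" "Re y < 1" by (auto simp: slit_cone_def)
      with 3 have "u * Re x < u" "v * Re y < v" by auto
      with * show ?thesis by simp
    qed
  qed
  ultimately show "?w \<in> slit_cone" by (simp add: slit_cone_def cone_def del: times_complex.sel)
qed

section \<open>The argument of the derivative and monotonicity along lines\<close>

text \<open>On the cone Im (1 - z^n) \<le> 0, so the logarithm of the base has imaginary part in
  (-\<pi>, 0]; the exponent -p carries this to [0, p \<pi>).\<close>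

lemma fn_polar:
  assumes "z \<in> slit_cone"
  obtains r \<alpha> where "0 < r" "0 \<le> \<alpha>" "\<alpha> < p * pi" "fn z = rcis r \<alpha>"
proof -
  let ?w = "1 - z ^ n"
  from assms have z: "z \<in> D" "z \<in> cone" by (simp_all add: slit_cone_iff)
  have w: "?w \<notin> \<real>\<^sub>\<le>\<^sub>0" using z by (simp add: D_def)
  then have w0: "?w \<noteq> 0" by auto
  have "Im ?w \<le> 0" using cone_power_Im[OF z(2)] by simp
  then have "Im (Ln ?w) \<le> 0"
    using w w0 Im_Ln_pos_lt[OF w0] Im_Ln_eq_pi[OF w0]
    by (smt (verit) Im_Ln_le_pi complex_nonpos_Reals_iff Im_Ln_eq_0)
  moreover have "- pi < Im (Ln ?w)" using w0 by (rule mpi_less_Im_Ln)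
  moreover have "fn z = rcis (exp (- p * Re (Ln ?w))) (- p * Im (Ln ?w))"
  proof -
    have "fn z = exp (of_real (- p) * Ln ?w)" using w0 by (simp add: fn_altdef powr_def)
    then show ?thesis by (simp add: exp_eq_polar rcis_def)
  qed
  ultimately show ?thesis
    using p_pos mult_strict_left_mono[of "- Im (Ln ?w)" pi p]
    by (intro that[of "exp (- p * Re (Ln ?w))" "- p * Im (Ln ?w)"]) (auto simp: mult_le_0_iff)
qed

lemma F_line_deriv:
  assumes "z1 + of_real t * d \<in> D"
  shows "((\<lambda>t. Re (c * F (z1 + of_real t * d))) has_real_derivative
           Re (c * (d * fn (z1 + of_real t * d)))) (at t)"
proof -
  have "((\<lambda>t. z1 + of_real t * d) has_vector_derivative (0 + 1 * d)) (at t)"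
    using has_vector_derivative_of_real[OF DERIV_ident]
    by (intro has_vector_derivative_add has_vector_derivative_const has_vector_derivative_mult_left) simp
  then have "((\<lambda>t. z1 + of_real t * d) has_vector_derivative d) (at t)" by simp
  from field_vector_diff_chain_at[OF this F_deriv[OF assms]]
  have "((\<lambda>t. F (z1 + of_real t * d)) has_vector_derivative d * fn (z1 + of_real t * d)) (at t)"
    by (simp add: o_def)
  then have "((\<lambda>t. c * F (z1 + of_real t * d)) has_vector_derivative c * (d * fn (z1 + of_real t * d))) (at t)"
    by (rule has_vector_derivative_mult_right)
  from bounded_linear.has_vector_derivative[OF bounded_linear_Re this]
  show ?thesis by (simp add: has_real_derivative_iff_has_vector_derivative del: times_complex.sel)
qed

lemma slit_cone_line:
  assumes "z \<in> slit_cone" "z + d \<in> slit_cone" "0 \<le> t" "t \<le> 1"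
  shows "z + of_real t * d \<in> slit_cone"
proof -
  have "(1 - t) *\<^sub>R z + t *\<^sub>R (z + d) \<in> slit_cone"
    using convex_slit_cone assms unfolding convex_alt by auto
  then show ?thesis by (simp add: scaleR_conv_of_real algebra_simps)
qed

lemma F_line_cos:
  assumes "z \<in> slit_cone"
  obtains r \<alpha> where "0 < r" "0 \<le> \<alpha>" "\<alpha> < p * pi"
    "Re (cis \<gamma> * (rcis s \<delta> * fn z)) = s * r * cos (\<gamma> + \<delta> + \<alpha>)"
proof -
  obtain r \<alpha> where *: "0 < r" "0 \<le> \<alpha>" "\<alpha> < p * pi" "fn z = rcis r \<alpha>"
    using fn_polar[OF assms] .
  have "cis \<gamma> * (rcis s \<delta> * fn z) = rcis (s * r) (\<gamma> + \<delta> + \<alpha>)"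
    unfolding *(4) rcis_mult rcis_cis_mult by (simp add: add.assoc)
  with * show ?thesis by (intro that[of r \<alpha>]) (simp_all del: times_complex.sel)
qed

text \<open>Along a segment of direction \<delta> the derivative of the rotated real part is a
  nonnegative multiple of cos (\<gamma> + \<delta> + \<alpha>), where \<alpha> is the argument of
  \<open>fn\<close>. The one-sided estimates for \<open>F\<close> below are instances with suitable
  \<gamma> and \<delta>.\<close>

lemma F_direction_mono:
  assumes "z \<in> slit_cone" "z + rcis s \<delta> \<in> slit_cone" "0 \<le> s"
    and cos: "\<And>\<alpha>. 0 \<le> \<alpha> \<Longrightarrow> \<alpha> < p * pi \<Longrightarrow> 0 \<le> cos (\<gamma> + \<delta> + \<alpha>)"
  shows "Re (cis \<gamma> * F z) \<le> Re (cis \<gamma> * F (z + rcis s \<delta>))"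
proof -
  define h where "h = (\<lambda>t. Re (cis \<gamma> * F (z + of_real t * rcis s \<delta>)))"
  have "h 0 \<le> h 1"
  proof (rule DERIV_nonneg_imp_nondecreasing[of 0 1 h])
    fix t :: real assume "0 \<le> t" "t \<le> 1"
    then have w: "z + of_real t * rcis s \<delta> \<in> slit_cone" using assms slit_cone_line by blast
    obtain r \<alpha> where *: "0 < r" "0 \<le> \<alpha>" "\<alpha> < p * pi"
      "Re (cis \<gamma> * (rcis s \<delta> * fn (z + of_real t * rcis s \<delta>))) = s * r * cos (\<gamma> + \<delta> + \<alpha>)"
      by (rule F_line_cos[OF w])
    have "0 \<le> s * r * cos (\<gamma> + \<delta> + \<alpha>)"
      using * cos[of \<alpha>] assms(3) by (intro mult_nonneg_nonneg) auto
    moreover have "z + of_real t * rcis s \<delta> \<in> D" using w by (simp add: slit_cone_iff)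
    note F_line_deriv[OF this, of "cis \<gamma>"]
    ultimately show "\<exists>y. (h has_real_derivative y) (at t) \<and> 0 \<le> y"
      unfolding *(4) h_def by blast
  qed simp
  then show ?thesis by (simp add: h_def)
qed

lemma F_direction_strict_mono:
  assumes "z \<in> slit_cone" "z + rcis s \<delta> \<in> slit_cone" "0 < s"
    and cos: "\<And>\<alpha>. 0 \<le> \<alpha> \<Longrightarrow> \<alpha> < p * pi \<Longrightarrow> 0 < cos (\<gamma> + \<delta> + \<alpha>)"
  shows "Re (cis \<gamma> * F z) < Re (cis \<gamma> * F (z + rcis s \<delta>))"
proof -
  define h where "h = (\<lambda>t. Re (cis \<gamma> * F (z + of_real t * rcis s \<delta>)))"
  have "h 0 < h 1"
  proof (rule DERIV_pos_imp_increasing[of 0 1 h])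
    fix t :: real assume "0 \<le> t" "t \<le> 1"
    then have w: "z + of_real t * rcis s \<delta> \<in> slit_cone" using assms slit_cone_line by blast
    obtain r \<alpha> where *: "0 < r" "0 \<le> \<alpha>" "\<alpha> < p * pi"
      "Re (cis \<gamma> * (rcis s \<delta> * fn (z + of_real t * rcis s \<delta>))) = s * r * cos (\<gamma> + \<delta> + \<alpha>)"
      by (rule F_line_cos[OF w])
    have "0 < s * r * cos (\<gamma> + \<delta> + \<alpha>)"
      using * cos[of \<alpha>] assms(3) by (intro mult_pos_pos) auto
    moreover have "z + of_real t * rcis s \<delta> \<in> D" using w by (simp add: slit_cone_iff)
    note F_line_deriv[OF this, of "cis \<gamma>"]
    ultimately show "\<exists>y. (h has_real_derivative y) (at t) \<and> 0 < y"
      unfolding *(4) h_def by blast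
  qed simp
  then show ?thesis by (simp add: h_def)
qed

text \<open>On the slit cone the argument of \<open>F'\<close> stays in \<open>[0, p \<pi>)\<close> with \<open>p < 1\<close>, so
  \<open>F\<close> is univalent there by the Noshiro--Warschawski argument.\<close>

lemma inj_on_F_slit_cone: "inj_on F slit_cone"
proof (rule inj_onI, rule ccontr)
  fix x y assume *: "x \<in> slit_cone" "y \<in> slit_cone" "F x = F y" "x \<noteq> y"
  define \<delta> where "\<delta> = Arg (y - x)"
  have y: "y = x + rcis (norm (y - x)) \<delta>" by (simp add: \<delta>_def rcis_cmod_Arg)
  \<comment> \<open>This rotation centres the range of the argument at 0, so that it stays inside
    (-\<pi>/2, \<pi>/2).\<close>
  have "Re (cis (- \<delta> - p * pi / 2) * F x) < Re (cis (- \<delta> - p * pi / 2) * F (x + rcis (norm (y - x)) \<delta>))"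
  proof (rule F_direction_strict_mono)
    fix \<alpha> assume "0 \<le> \<alpha>" "\<alpha> < p * pi"
    moreover have "p * pi < pi" using p_less_1 by simp
    ultimately show "0 < cos (- \<delta> - p * pi / 2 + \<delta> + \<alpha>)"
      by (intro cos_gt_zero_pi; linarith)
  qed (use * y in auto)
  with y * show False by simp
qed

section \<open>The image of the sector lies in the sector\<close>

text \<open>Every point of the cone is reached from a point of the ray through \<open>e\<close> by a
  step in direction -\<beta>. As \<open>F\<close> is known on that ray, monotonicity along the step
  gives bounds at z. The choices of \<beta> below are 0, (k - 1) \<theta> and \<theta>.\<close>

lemma cone_coordinates:
  assumes "z \<in> cone" "0 \<le> \<beta>" "\<theta> + \<beta> < pi"
  obtains a s where "0 \<le> a" "0 \<le> s" "z = of_real a * e + rcis s (- \<beta>)"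
    "a * sin (\<theta> + \<beta>) = Im (cis \<beta> * z)" "s * sin (\<theta> + \<beta>) = - Im (cis (- \<theta>) * z)"
proof -
  let ?S = "sin (\<theta> + \<beta>)"
  have S: "?S > 0" using assms \<theta> by (intro sin_gt_zero) auto
  obtain t where t: "0 \<le> t" "t \<le> \<theta>" "z = rcis (norm z) t" using assms(1) by (rule cone_polar)
  have "cis \<beta> * z = rcis (norm z) (\<beta> + t)" by (subst t(3)) (simp add: rcis_cis_mult)
  moreover have "0 \<le> sin (\<beta> + t)" using t assms by (intro sin_ge_zero) auto
  ultimately have 1: "0 \<le> Im (cis \<beta> * z)" by simp
  have 2: "0 \<le> - Im (cis (- \<theta>) * z)" using assms(1) by (simp add: cone_def)
  show ?thesis
  proof (rule that)
    show "z = of_real (Im (cis \<beta> * z) / ?S) * e + rcis (- Im (cis (- \<theta>) * z) / ?S) (- \<beta>)"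
      unfolding rcis_def e_def using S by (intro oblique_coordinates) simp
    show "0 \<le> Im (cis \<beta> * z) / ?S" using 1 S by simp
    show "0 \<le> - Im (cis (- \<theta>) * z) / ?S" using 2 S by (rule divide_nonneg_pos)
  qed (use S in simp_all)
qed

lemma e_rcis: "of_real a * e = rcis a \<theta>"
  by (simp add: rcis_def e_def)

lemma ray_in_slit_cone: "0 \<le> a \<Longrightarrow> of_real a * e \<in> slit_cone"
  using ray_in_D rcis_in_cone[of a \<theta>] \<theta> by (simp add: slit_cone_iff e_rcis)

lemma Re_cis_F_ray: "0 \<le> a \<Longrightarrow> Re (cis \<gamma> * F (of_real a * e)) = G a * cos (\<gamma> + \<theta>)"
  by (subst F_ray) (simp_all add: e_rcis rcis_cis_mult del: times_complex.sel)

text \<open>A horizontal step from the ray to z does not decrease Im \<open>F\<close>, because the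
  argument of \<open>fn\<close> lies in [0, \<pi>).\<close>

lemma Im_F_ge:
  assumes "z \<in> slit_cone"
  obtains a where "0 \<le> a" "a * sin \<theta> = Im z" "G a * sin \<theta> \<le> Im (F z)"
proof -
  have z: "z \<in> cone" using assms by (simp add: slit_cone_iff)
  obtain a s where *: "0 \<le> a" "0 \<le> s" "z = of_real a * e + rcis s (- 0)"
    "a * sin (\<theta> + 0) = Im (cis 0 * z)"
    by (rule cone_coordinates[OF z, of 0]) (use \<theta> pi_gt_zero in auto)
  have "Re (cis (- (pi / 2)) * F (of_real a * e)) \<le> Re (cis (- (pi / 2)) * F (of_real a * e + rcis s (- 0)))"
  proof (rule F_direction_mono)
    fix \<alpha> assume "0 \<le> \<alpha>" "\<alpha> < p * pi"
    moreover have "p * pi < pi" using p_less_1 by simp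
    ultimately show "0 \<le> cos (- (pi / 2) + - 0 + \<alpha>)"
      by (intro cos_ge_zero; linarith)
  qed (use * assms ray_in_slit_cone in auto)
  then have "G a * sin \<theta> \<le> Im (F z)"
    unfolding Re_cis_F_ray[OF *(1)] *(3)[symmetric]
    by (simp add: Re_cis_mult cos_diff[of \<theta> "pi / 2"] add.commute)
  with * that show ?thesis by simp
qed

text \<open>Along direction -(k - 1) \<theta> the derivative of \<open>cis (- \<theta>) * F\<close>
  has argument in [-p \<pi>, 0), since \<theta> + (k - 1) \<theta> = p \<pi>. Its imaginary part
  thus decreases strictly from the value 0 on the ray.\<close>

lemma F_below_ray:
  assumes "z \<in> slit_cone"
  shows "Im (cis (- \<theta>) * F z) \<le> 0" and "Im (cis (- \<theta>) * z) < 0 \<Longrightarrow> Im (cis (- \<theta>) * F z) < 0"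
proof -
  let ?\<beta> = "(real k - 1) * \<theta>"
  have z: "z \<in> cone" using assms by (simp add: slit_cone_iff)
  have kt: "\<theta> + ?\<beta> = p * pi" "p * pi < pi" "0 \<le> ?\<beta>"
  proof -
    show "\<theta> + ?\<beta> = p * pi" using \<theta> by (simp add: algebra_simps)
    show "p * pi < pi" using p_less_1 by simp
    show "0 \<le> ?\<beta>" using \<theta> k_ge_1 by simp
  qed
  obtain a s where *: "0 \<le> a" "0 \<le> s" "z = of_real a * e + rcis s (- ?\<beta>)"
    "s * sin (\<theta> + ?\<beta>) = - Im (cis (- \<theta>) * z)"
    by (rule cone_coordinates[OF z, of ?\<beta>]) (use kt in auto)
  have "Re (cis (- \<theta> + pi / 2) * F (of_real a * e)) = 0"
    by (subst Re_cis_F_ray[OF *(1)]) simp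
  moreover have "Re (cis (- \<theta> + pi / 2) * F z) = - Im (cis (- \<theta>) * F z)"
    by (simp add: Re_cis_mult Im_cis_mult cos_add sin_add cos_diff sin_diff del: times_complex.sel)
  moreover have "Re (cis (- \<theta> + pi / 2) * F (of_real a * e)) < Re (cis (- \<theta> + pi / 2) * F z)" if "s > 0"
    unfolding *(3)
  proof (rule F_direction_strict_mono)
    fix \<alpha> assume "0 \<le> \<alpha>" "\<alpha> < p * pi"
    then show "0 < cos (- \<theta> + pi / 2 + - ?\<beta> + \<alpha>)"
      using kt by (intro cos_gt_zero_pi; linarith)
  qed (use * assms ray_in_slit_cone that in auto)
  moreover have "Im (cis (- \<theta>) * z) = 0" if "s = 0" using *(4) that by simp
  moreover have "F z = F (of_real a * e)" if "s = 0" using *(3) that by simp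
  ultimately show "Im (cis (- \<theta>) * F z) \<le> 0" "Im (cis (- \<theta>) * z) < 0 \<Longrightarrow> Im (cis (- \<theta>) * F z) < 0"
    using *(2) by (cases "s = 0"; force)+
qed

lemma F_in_cone:
  assumes "z \<in> slit_cone"
  shows "F z \<in> cone"
proof -
  obtain a where "0 \<le> a" "G a * sin \<theta> \<le> Im (F z)" using Im_F_ge[OF assms] .
  moreover have "0 \<le> G a * sin \<theta>" using \<theta> G_nonneg by simp
  ultimately show ?thesis using F_below_ray(1)[OF assms] unfolding cone_def by simp
qed

lemma zero_in_slit_cone [simp]: "0 \<in> slit_cone"
  by (simp add: slit_cone_def cone_def)

lemma closed_cone: "closed cone"
proof -
  have "closed {z. 0 \<le> Im z}" "closed {z. Im (cis (- \<theta>) * z) \<le> 0}"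
    by (rule closed_Collect_le; intro continuous_intros)+
  then show ?thesis unfolding cone_def by (rule closed_Collect_conj)
qed

section \<open>Univalence on the slit plane\<close>

lemma cone_power_polar:
  assumes "z \<in> cone"
  obtains t :: real where "0 \<le> t" "t \<le> \<theta>" "z = rcis (norm z) t" "z ^ n = rcis (norm z ^ n) (real n * t)"
    "0 \<le> real n * t" "real n * t \<le> pi"
proof -
  obtain t where t: "0 \<le> t" "t \<le> \<theta>" "z = rcis (norm z) t" using assms by (rule cone_polar)
  moreover have "z ^ n = rcis (norm z ^ n) (real n * t)" using t(3) by (metis DeMoivre2)
  moreover have "0 \<le> real n * t" "real n * t \<le> pi" using t n_pos \<theta> mult_left_mono[OF t(2), of n] by auto
  ultimately show ?thesis using that by blast
qed

text \<open>The angle n t stays in [0, \<pi>], where cosine is injective. This recovers a point of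
  the cone from its n-th power, which is blind to rotations by roots of unity.\<close>

lemma inj_on_power_cone: "inj_on (\<lambda>z. z ^ n) cone"
proof (rule inj_onI)
  fix x y assume x: "x \<in> cone" and y: "y \<in> cone" and eq: "x ^ n = y ^ n"
  obtain s where s: "0 \<le> s" "s \<le> \<theta>" "x = rcis (norm x) s" "x ^ n = rcis (norm x ^ n) (real n * s)"
    "0 \<le> real n * s" "real n * s \<le> pi" using x by (rule cone_power_polar)
  obtain t where t: "0 \<le> t" "t \<le> \<theta>" "y = rcis (norm y) t" "y ^ n = rcis (norm y ^ n) (real n * t)"
    "0 \<le> real n * t" "real n * t \<le> pi" using y by (rule cone_power_polar)
  have "norm x ^ n = norm y ^ n" using eq by (metis norm_power)
  then have r: "norm x = norm y" using n_pos by (simp add: power_eq_iff_eq_base)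
  show "x = y"
  proof (cases "norm x = 0")
    case True with r show ?thesis by simp
  next
    case False
    have "rcis (norm x ^ n) (real n * s) = rcis (norm x ^ n) (real n * t)"
      using trans[OF s(4)[symmetric] trans[OF eq t(4)]] by (simp only: r)
    from arg_cong[OF this, of Re] have "norm x ^ n * cos (real n * s) = norm x ^ n * cos (real n * t)"
      by (simp only: Re_rcis)
    with False have "cos (real n * s) = cos (real n * t)" by simp
    then have "real n * s = real n * t"
      by (rule cos_inj_pi[OF s(5,6) t(5,6)])
    then have "s = t" using n_pos by simp
    then show ?thesis using s(3) unfolding r by (simp only: t(3)[symmetric])
  qed
qed

text \<open>The n-th power takes the interior of the sector to the open upper half-plane and its two
  sides to the real axis.\<close>

lemma cone_power_Im_pos_iff:
  assumes "z \<in> cone"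
  shows "0 < Im (z ^ n) \<longleftrightarrow> 0 < Im z \<and> Im (cis (- \<theta>) * z) < 0"
proof -
  obtain t where t: "0 \<le> t" "t \<le> \<theta>" "z = rcis (norm z) t" "z ^ n = rcis (norm z ^ n) (real n * t)"
    "0 \<le> real n * t" "real n * t \<le> pi" using assms by (rule cone_power_polar)
  define r where "r = norm z"
  have 1: "Im (z ^ n) = r ^ n * sin (real n * t)" using t(4) by (simp add: r_def)
  have 2: "Im z = r * sin t" using t(3) by (metis Im_rcis r_def)
  have 3: "Im (cis (- \<theta>) * z) = - (r * sin (\<theta> - t))"
    by (subst t(3)) (simp add: rcis_cis_mult r_def sin_diff algebra_simps del: times_complex.sel)
  have r: "r \<ge> 0" by (simp add: r_def)
  show ?thesis
  proof (cases "r = 0 \<or> t = 0 \<or> t = \<theta>")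
    case True
    then consider "r = 0" | "t = 0" | "t = \<theta>" by blast
    then show ?thesis
    proof cases
      case 1 then show ?thesis unfolding \<open>Im (z ^ n) = _\<close> 2 3 using n_pos by (simp add: power_0_left)
    next
      case 2 then show ?thesis unfolding 1 \<open>Im z = _\<close> 3 by simp
    next
      case t: 3 show ?thesis unfolding 1 2 \<open>Im (cis _ * z) = _\<close> t \<theta>(3) by simp
    qed
  next
    case False
    with t r have *: "r > 0" "t > 0" "t < \<theta>" by auto
    have "real n * t < n * \<theta>" using * n_pos by simp
    then have "sin (real n * t) > 0" using * n_pos \<theta>(3) by (intro sin_gt_zero) auto
    moreover have "sin t > 0" "sin (\<theta> - t) > 0" using * \<theta> pi_gt_zero by (auto intro!: sin_gt_zero)
    ultimately show ?thesis unfolding 1 2 3 using * by simp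
  qed
qed

text \<open>The point of modulus |z| and argument Arg (z^n) / n lies in the cone and has the same
  n-th power as z, so it differs from z by a root of unity.\<close>

lemma upper_representative:
  assumes "z \<in> D" "0 \<le> Im (z ^ n)"
  obtains x \<omega> where "x \<in> slit_cone" "\<omega> ^ n = 1" "z = \<omega> * x" "x ^ n = z ^ n"
proof (cases "z = 0")
  case True
  with that[of 0 1] show ?thesis by simp
next
  case False
  let ?w = "z ^ n"
  define x where "x = rcis (norm z) (Arg ?w / n)"
  have arg: "0 \<le> Arg ?w" "Arg ?w \<le> pi" using assms(2) Arg_bounded Arg_less_0 by auto
  have xn: "x ^ n = ?w"
    unfolding x_def DeMoivre2 using n_pos rcis_cmod_Arg[of ?w] by (simp add: norm_power)
  have "x \<in> cone"
    unfolding x_def using arg n_pos by (intro rcis_in_cone) (auto simp: \<theta>_def divide_right_mono)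
  moreover have "x \<in> D" using assms(1) by (simp add: in_D_iff xn)
  ultimately have "x \<in> slit_cone" by (simp add: slit_cone_iff)
  moreover have "x \<noteq> 0" using False by (simp add: x_def rcis_def)
  moreover from this have "(z / x) ^ n = 1" using False xn by (simp add: power_divide)
  ultimately show ?thesis using xn by (intro that[of x "z / x"]) auto
qed

text \<open>After rotation into the cone this says that \<open>F\<close> maps the sector into itself
  and interior points to interior points. It later separates the sectors on which Im (z^n) has
  opposite signs.\<close>

lemma F_power_Im:
  assumes "z \<in> D" "0 \<le> Im (z ^ n)"
  shows "0 \<le> Im (F z ^ n)" and "0 < Im (z ^ n) \<Longrightarrow> 0 < Im (F z ^ n)"
proof -
  obtain x \<omega> where x: "x \<in> slit_cone" "\<omega> ^ n = 1" "z = \<omega> * x" "x ^ n = z ^ n"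
    using upper_representative[OF assms] .
  have eq: "F z ^ n = F x ^ n" using x F_rotate by (simp add: power_mult_distrib)
  show "0 \<le> Im (F z ^ n)" unfolding eq using F_in_cone[OF x(1)] by (rule cone_power_Im)
  assume "0 < Im (z ^ n)"
  then have *: "0 < Im x" "Im (cis (- \<theta>) * x) < 0"
    using cone_power_Im_pos_iff[of x] x by (auto simp: slit_cone_iff)
  obtain a where a: "0 \<le> a" "a * sin \<theta> = Im x" "G a * sin \<theta> \<le> Im (F x)" using Im_F_ge[OF x(1)] .
  with * have "a > 0" using less_eq_real_def by force
  then have "0 < Im (F x)" using a \<theta> G_pos[of a] by (smt (verit) mult_pos_pos)
  then show "0 < Im (F z ^ n)"
    unfolding eq cone_power_Im_pos_iff[OF F_in_cone[OF x(1)]]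
    using F_below_ray(2)[OF x(1) *(2)] by simp
qed

text \<open>Taking n-th powers removes the rotations, so the representatives in the cone coincide; a
  nonzero value of \<open>F\<close> there then forces equal roots of unity.\<close>

lemma inj_upper:
  assumes "x \<in> D" "0 \<le> Im (x ^ n)" "y \<in> D" "0 \<le> Im (y ^ n)" "F x = F y"
  shows "x = y"
proof -
  obtain x' \<omega> where x: "x' \<in> slit_cone" "\<omega> ^ n = 1" "x = \<omega> * x'" "x' ^ n = x ^ n"
    using upper_representative[OF assms(1,2)] .
  obtain y' \<eta> where y: "y' \<in> slit_cone" "\<eta> ^ n = 1" "y = \<eta> * y'" "y' ^ n = y ^ n"
    using upper_representative[OF assms(3,4)] .
  have eq: "\<omega> * F x' = \<eta> * F y'" using assms(5) x y F_rotate by simp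
  then have "F x' ^ n = F y' ^ n"
    using x(2) y(2) by (metis mult_1 power_mult_distrib)
  then have "F x' = F y'"
    using inj_on_power_cone F_in_cone x(1) y(1) by (meson inj_onD)
  then have xy: "x' = y'" using inj_on_F_slit_cone x(1) y(1) by (meson inj_onD)
  show ?thesis
  proof (cases "x' = 0")
    case True with x y xy show ?thesis by simp
  next
    case False
    then have "F x' \<noteq> 0"
      using inj_on_F_slit_cone x(1) zero_in_slit_cone F_0 by (metis inj_onD)
    with eq xy have "\<omega> = \<eta>" by simp
    then show ?thesis using x y xy by simp
  qed
qed

text \<open>Conjugation reduces the case of two nonpositive Im (z^n) to \<open>inj_upper\<close>. In
  the mixed case the imaginary parts of the n-th powers of the images have incompatible
  signs.\<close>

lemma inj_on_F: "inj_on F D"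
proof (rule inj_onI)
  fix x y assume xy: "x \<in> D" "y \<in> D" "F x = F y"
  have cnj: "F (cnj x) = F (cnj y)" using xy by (simp add: F_cnj)
  have Im_cnj: "Im (cnj z ^ n) = - Im (z ^ n)" for z :: complex
    by (simp flip: complex_cnj_power)
  have mixed: False if "u \<in> D" "v \<in> D" "F u = F v" "0 < Im (u ^ n)" "Im (v ^ n) \<le> 0" for u v
  proof -
    have "0 < Im (F u ^ n)" using F_power_Im(2)[OF that(1)] that(4) by linarith
    moreover have "0 \<le> Im (F (cnj v) ^ n)" using F_power_Im(1)[of "cnj v"] that Im_cnj by simp
    then have "Im (F v ^ n) \<le> 0" using F_cnj[OF that(2)] Im_cnj by simp
    ultimately show False unfolding that(3) by linarith
  qed
  consider "0 \<le> Im (x ^ n)" "0 \<le> Im (y ^ n)" | "Im (x ^ n) \<le> 0" "Im (y ^ n) \<le> 0"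
    | "0 < Im (x ^ n)" "Im (y ^ n) \<le> 0" | "0 < Im (y ^ n)" "Im (x ^ n) \<le> 0" by linarith
  then show "x = y"
  proof cases
    case 1 show ?thesis by (rule inj_upper) (use 1 xy in simp_all)
  next
    case 2
    have "cnj x = cnj y"
      by (rule inj_upper) (use 2 xy cnj in \<open>simp_all add: Im_cnj\<close>)
    then show ?thesis by simp
  next
    case 3 with xy mixed show ?thesis by blast
  next
    case 4 with xy mixed[of y x] show ?thesis by metis
  qed
qed

section \<open>Bounds for \<open>F\<close> near infinity and near the slits\<close>

text \<open>With \<beta> = \<theta> one has a sin (2\<theta>) = |z| sin (\<theta> + t), and sin
  (\<theta> + t) \<ge> sin (2\<theta>) / 2. So the starting point on the ray tends to infinity
  together with z.\<close>

lemma bisector_coordinates: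
  assumes "z \<in> cone"
  obtains a s where "norm z / 2 \<le> a" "0 \<le> s" "z = of_real a * e + rcis s (- \<theta>)"
proof -
  have sum: "\<theta> + \<theta> < pi" using \<theta> pi_gt_zero by linarith
  obtain a s where *: "0 \<le> a" "0 \<le> s" "z = of_real a * e + rcis s (- \<theta>)"
    "a * sin (\<theta> + \<theta>) = Im (cis \<theta> * z)"
    by (rule cone_coordinates[OF assms, of \<theta>]) (use sum \<theta> in auto)
  obtain t where t: "0 \<le> t" "t \<le> \<theta>" "z = rcis (norm z) t" using assms by (rule cone_polar)
  have "0 \<le> sin t * cos \<theta>" using t \<theta> sum by (intro mult_nonneg_nonneg sin_ge_zero) auto
  moreover have "cos \<theta> \<le> cos t" using t \<theta> pi_gt_zero by (subst cos_mono_le_eq) auto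
  then have "cos \<theta> * sin \<theta> \<le> cos t * sin \<theta>" using \<theta> by simp
  ultimately have "cos \<theta> * sin \<theta> \<le> sin (\<theta> + t)" by (simp add: sin_add mult.commute)
  then have "norm z * (cos \<theta> * sin \<theta>) \<le> norm z * sin (\<theta> + t)" by (rule mult_left_mono) simp
  also have "norm z * sin (\<theta> + t) = Im (cis \<theta> * z)"
    using arg_cong[OF t(3), of "\<lambda>w. Im (cis \<theta> * w)"] by (simp only: rcis_cis_mult Im_rcis)
  also have "\<dots> = 2 * a * (cos \<theta> * sin \<theta>)" unfolding *(4)[symmetric] sin_add by simp
  finally have "norm z \<le> 2 * a" using \<theta> by (simp add: mult_le_cancel_right)
  then show ?thesis by (intro that[OF _ *(2,3)]) simp
qed

lemma F_ge_at_infinity: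
  assumes "z \<in> slit_cone"
    and "\<And>\<alpha>. 0 \<le> \<alpha> \<Longrightarrow> \<alpha> < p * pi \<Longrightarrow> 0 \<le> cos (\<gamma> - \<theta> + \<alpha>)" and "0 \<le> cos (\<gamma> + \<theta>)"
  shows "G (norm z / 2) * cos (\<gamma> + \<theta>) \<le> Re (cis \<gamma> * F z)"
proof -
  have "z \<in> cone" using assms by (simp add: slit_cone_iff)
  then obtain a s where *: "norm z / 2 \<le> a" "0 \<le> s" "z = of_real a * e + rcis s (- \<theta>)"
    by (rule bisector_coordinates)
  have a: "0 \<le> a" using *(1) norm_ge_zero[of z] by linarith
  have "G (norm z / 2) * cos (\<gamma> + \<theta>) \<le> G a * cos (\<gamma> + \<theta>)"
    using G_mono[OF *(1)] assms(3) by (rule mult_right_mono)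
  also have "\<dots> = Re (cis \<gamma> * F (of_real a * e))" by (simp only: Re_cis_F_ray[OF a])
  also have "\<dots> \<le> Re (cis \<gamma> * F (of_real a * e + rcis s (- \<theta>)))"
    using assms * a ray_in_slit_cone by (intro F_direction_mono) auto
  finally show ?thesis using *(3) by simp
qed

text \<open>Rotation by \<pi>/2 - p \<pi> makes the real part the component normal to the side that
  leaves \<open>phi n k\<close> in direction \<open>cis (p * pi)\<close>; on that side it equals
  \<open>phi n k * sin (p * pi)\<close>. Continuity at a real a < 1 gives the bound on a short
  vertical segment, and moving right does not decrease the component.\<close>

lemma F_ge_near_slit:
  assumes "\<epsilon> > 0"
  obtains a \<eta> where "0 < a" "a < 1" "0 < \<eta>"
    "\<And>z. z \<in> slit_cone \<Longrightarrow> a \<le> Re z \<Longrightarrow> Im z < \<eta> \<Longrightarrow>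
      phi n k * sin (p * pi) - \<epsilon> \<le> Re (cis (pi / 2 - p * pi) * F z)"
proof -
  let ?\<gamma> = "pi / 2 - p * pi"
  have "((\<lambda>x. E x * sin (p * pi)) \<longlongrightarrow> phi n k * sin (p * pi)) (at_left 1)"
    by (intro tendsto_intros E_tendsto_phi)
  then have "\<forall>\<^sub>F x in at_left 1. phi n k * sin (p * pi) - \<epsilon> / 2 < E x * sin (p * pi)"
    using assms by (intro order_tendstoD) auto
  moreover have "\<forall>\<^sub>F x in at_left (1::real). 0 < x \<and> x < 1"
    by (rule eventually_at_leftI[of 0]) auto
  ultimately have "\<forall>\<^sub>F x in at_left 1. phi n k * sin (p * pi) - \<epsilon> / 2 < E x * sin (p * pi) \<and> 0 < x \<and> x < 1"
    by (rule eventually_conj)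
  from eventually_happens'[OF trivial_limit_at_left_real this]
  obtain a where a: "phi n k * sin (p * pi) - \<epsilon> / 2 < E a * sin (p * pi)" "0 < a" "a < 1" by blast
  have "isCont (\<lambda>z. Re (cis ?\<gamma> * F z)) (of_real a)"
    using F_deriv[of "of_real a"] of_real_in_D[of a] a
    by (intro isCont_Re continuous_mult continuous_const DERIV_isCont) auto
  then obtain \<eta> where \<eta>: "\<eta> > 0"
    "\<And>z. dist z (of_real a) < \<eta> \<Longrightarrow> dist (Re (cis ?\<gamma> * F z)) (Re (cis ?\<gamma> * F (of_real a))) < \<epsilon> / 2"
    unfolding continuous_at_eps_delta using assms by (meson half_gt_zero)
  have Fa: "Re (cis ?\<gamma> * F (of_real a)) = E a * sin (p * pi)"
    using F_of_real[of a] a by (simp add: Re_cis_mult cos_diff)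
  \<comment> \<open>The second entry keeps the point above a at height Im z below the ray through
    \<open>e\<close>, hence in the slit cone.\<close>
  define \<eta>' where "\<eta>' = min \<eta> (a * sin \<theta>)"
  show ?thesis
  proof (rule that[of a \<eta>'])
    show "0 < \<eta>'" using \<eta> a \<theta> by (simp add: \<eta>'_def)
  next
    fix z assume z: "z \<in> slit_cone" "a \<le> Re z" "Im z < \<eta>'"
    let ?w = "Complex a (Im z)"
    have Imz: "0 \<le> Im z" using z by (simp add: slit_cone_def cone_def)
    have "cos \<theta> * Im z \<le> 1 * Im z" using Imz by (intro mult_right_mono) auto
    also have "\<dots> \<le> a * sin \<theta>" using z by (simp add: \<eta>'_def)
    finally have w: "?w \<in> slit_cone"
      using Imz a by (simp add: slit_cone_def cone_def mult.commute)
    have zw: "?w + rcis (Re z - a) 0 = z" by (simp add: complex_eq_iff)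
    have "Re (cis ?\<gamma> * F ?w) \<le> Re (cis ?\<gamma> * F (?w + rcis (Re z - a) 0))"
    proof (rule F_direction_mono)
      show "?w + rcis (Re z - a) 0 \<in> slit_cone" using z(1) unfolding zw .
      fix \<alpha> assume "0 \<le> \<alpha>" "\<alpha> < p * pi"
      moreover have "p * pi < pi" using p_less_1 by simp
      ultimately show "0 \<le> cos (?\<gamma> + 0 + \<alpha>)" by (intro cos_ge_zero; linarith)
    qed (use w z in auto)
    then have "Re (cis ?\<gamma> * F ?w) \<le> Re (cis ?\<gamma> * F z)" unfolding zw .
    moreover have "dist ?w (of_real a) < \<eta>"
      using z Imz by (simp add: dist_norm \<eta>'_def cmod_def)
    note \<eta>(2)[OF this]
    ultimately show "phi n k * sin (p * pi) - \<epsilon> \<le> Re (cis ?\<gamma> * F z)"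
      using a(1) unfolding Fa dist_real_def by linarith
  qed (use a in auto)
qed

text \<open>At argument t the normal component is |w| sin (p \<pi> - t). Lower bounds on that
  component thus become lower bounds on |w|.\<close>

lemma Re_le_norm_cone:
  assumes "w \<in> cone" and "\<And>t. 0 \<le> t \<Longrightarrow> t \<le> \<theta> \<Longrightarrow> sin (p * pi - t) \<le> M"
  shows "Re (cis (pi / 2 - p * pi) * w) \<le> norm w * M"
proof -
  obtain t where t: "0 \<le> t" "t \<le> \<theta>" "w = rcis (norm w) t" using assms(1) by (rule cone_polar)
  have "Re (cis (pi / 2 - p * pi) * w) = norm w * cos (pi / 2 - p * pi + t)"
    using arg_cong[OF t(3), of "\<lambda>w. Re (cis (pi / 2 - p * pi) * w)"] by (simp only: rcis_cis_mult Re_rcis)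
  also have "cos (pi / 2 - p * pi + t) = sin (p * pi - t)"
    by (simp add: cos_add cos_diff sin_diff)
  also have "norm w * sin (p * pi - t) \<le> norm w * M"
    using assms(2) t by (intro mult_left_mono) auto
  finally show ?thesis .
qed

section \<open>Discs covered by the image\<close>

text \<open>Rotation and reflection preserve both moduli. The n-th power is folded into the closed
  upper half-plane, a continuous operation that survives passage to limits.\<close>

lemma representative:
  assumes "z \<in> D"
  obtains x where "x \<in> slit_cone" "norm x = norm z" "norm (F x) = norm (F z)"
    "x ^ n = Complex (Re (z ^ n)) \<bar>Im (z ^ n)\<bar>"
proof -
  note result = that
  have *: thesis if u: "u \<in> D" "0 \<le> Im (u ^ n)" "norm u = norm z" "norm (F u) = norm (F z)"
    "u ^ n = Complex (Re (z ^ n)) \<bar>Im (z ^ n)\<bar>" for u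
  proof -
    obtain x \<omega> where x: "x \<in> slit_cone" "\<omega> ^ n = 1" "u = \<omega> * x" "x ^ n = u ^ n"
      using upper_representative[OF u(1,2)] .
    have "norm \<omega> ^ n = 1" using x(2) by (metis norm_one norm_power)
    then have "norm \<omega> = 1" using n_pos power_eq_imp_eq_base[of "norm \<omega>" n 1] by simp
    then show ?thesis
      using x u F_rotate[OF x(2), of x] by (intro result[of x]) (auto simp: norm_mult)
  qed
  show ?thesis
  proof (cases "0 \<le> Im (z ^ n)")
    case True
    then show ?thesis by (intro *[of z]) (use assms in \<open>auto simp: complex_eq_iff\<close>)
  next
    case False
    then show ?thesis
      by (intro *[of "cnj z"]) (use assms in \<open>auto simp: complex_eq_iff F_cnj simp flip: complex_cnj_power\<close>)
  qed
qed

text \<open>Preimages of points of modulus less than \<open>\<rho>\<close> can escape neither to infinity nor to the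
  slits, so that the image of \<open>F\<close> is relatively closed in the disc of radius \<open>\<rho>\<close>.\<close>

lemma ball_subset_image:
  assumes M: "M > 0" "\<And>t. 0 \<le> t \<Longrightarrow> t \<le> \<theta> \<Longrightarrow> sin (p * pi - t) \<le> M"
    and \<rho>: "\<rho> * M = phi n k * sin (p * pi)"
    and infinity: "\<And>r. r < \<rho> \<Longrightarrow> \<exists>b. \<forall>z\<in>slit_cone. norm (F z) \<le> r \<longrightarrow> norm z \<le> b"
  shows "ball 0 \<rho> \<subseteq> F ` D"
proof -
  have open_img: "open (F ` D)"
    using holomorphic_F open_D inj_on_F by (rule open_mapping_thm3)
  have sub: "w \<in> F ` D" if w: "w \<in> closure (F ` D)" "norm w < \<rho>" for w
  proof -
    obtain f where f: "\<And>i. f i \<in> F ` D" "f \<longlonglongrightarrow> w" using w(1) unfolding closure_sequential by blast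
    from f(1) have "\<forall>i. \<exists>z. z \<in> D \<and> f i = F z" by blast
    from choice[OF this] obtain z where z: "\<And>i. z i \<in> D" "\<And>i. f i = F (z i)" by blast
    obtain r where r: "norm w < r" "r < \<rho>" using w(2) dense by blast
    have "\<forall>\<^sub>F i in sequentially. norm (f i) < r"
      using tendsto_norm[OF f(2)] r(1) by (rule order_tendstoD)
    then obtain N where N: "\<And>i. i \<ge> N \<Longrightarrow> norm (f i) < r" by (auto simp: eventually_sequentially)
    obtain b where b: "\<And>z. z \<in> slit_cone \<Longrightarrow> norm (F z) \<le> r \<Longrightarrow> norm z \<le> b"
      using infinity[OF r(2)] by blast
    have "\<forall>i. \<exists>x. x \<in> slit_cone \<and> norm x = norm (z i) \<and> norm (F x) = norm (F (z i)) \<and>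
        x ^ n = Complex (Re (z i ^ n)) \<bar>Im (z i ^ n)\<bar>"
    proof
      show "\<exists>x. x \<in> slit_cone \<and> norm x = norm (z i) \<and> norm (F x) = norm (F (z i)) \<and>
          x ^ n = Complex (Re (z i ^ n)) \<bar>Im (z i ^ n)\<bar>" for i
        by (rule representative[OF z(1)[of i]]) blast
    qed
    from choice[OF this] obtain x where x: "\<And>i. x i \<in> slit_cone" "\<And>i. norm (x i) = norm (z i)"
      "\<And>i. norm (F (x i)) = norm (F (z i))" "\<And>i. x i ^ n = Complex (Re (z i ^ n)) \<bar>Im (z i ^ n)\<bar>"
      by blast
    \<comment> \<open>Points and representatives are put into one compact product so that a single
      subsequence makes both converge.\<close>
    have bounded: "(z (i + N), x (i + N)) \<in> cball 0 b \<times> cball 0 b" for i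
      using b[of "x (i + N)"] x N[of "i + N"] z(2) by (simp add: less_imp_le)
    have "seq_compact (cball (0::complex) b \<times> cball (0::complex) b)"
      by (intro compact_imp_seq_compact compact_Times compact_cball)
    then obtain l s where s: "strict_mono s" "((\<lambda>i. (z (i + N), x (i + N))) \<circ> s) \<longlonglongrightarrow> l"
      by (rule seq_compactE[where f = "\<lambda>i. (z (i + N), x (i + N))"]) (use bounded in blast)+
    define \<sigma> where "\<sigma> i = s i + N" for i
    obtain l1 l2 where l: "l = (l1, l2)" by force
    have lim: "(\<lambda>i. z (\<sigma> i)) \<longlonglongrightarrow> l1" "(\<lambda>i. x (\<sigma> i)) \<longlonglongrightarrow> l2"
      using tendsto_fst[OF s(2)] tendsto_snd[OF s(2)] by (simp_all add: l \<sigma>_def o_def)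
    have "strict_mono \<sigma>" using s(1) by (simp add: \<sigma>_def strict_mono_def)
    then have fw: "(\<lambda>i. F (z (\<sigma> i))) \<longlonglongrightarrow> w"
      using LIMSEQ_subseq_LIMSEQ[OF f(2)] by (simp add: o_def z(2))
    show ?thesis
    proof (cases "l1 \<in> D")
      case True
      have "isCont F l1" using F_deriv[OF True] by (rule DERIV_isCont)
      then have "(\<lambda>i. F (z (\<sigma> i))) \<longlonglongrightarrow> F l1" using lim(1) by (rule isCont_tendsto_compose)
      with fw have "w = F l1" by (rule LIMSEQ_unique)
      with True show ?thesis by blast
    next
      case False
      \<comment> \<open>Folding commutes with the limit, so \<open>l2\<close> lies outside
        \<open>D\<close> just as \<open>l1\<close> does; being in the closed cone, it lies on the
        slit [1, infinity).\<close>
      have "(\<lambda>i. x (\<sigma> i) ^ n) \<longlonglongrightarrow> Complex (Re (l1 ^ n)) \<bar>Im (l1 ^ n)\<bar>"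
        unfolding x(4) by (intro tendsto_intros lim)
      moreover have "(\<lambda>i. x (\<sigma> i) ^ n) \<longlonglongrightarrow> l2 ^ n" by (intro tendsto_intros lim)
      ultimately have "l2 ^ n = Complex (Re (l1 ^ n)) \<bar>Im (l1 ^ n)\<bar>" using LIMSEQ_unique by blast
      with False have "l2 \<notin> D" by (auto simp: in_D_iff)
      moreover have "l2 \<in> cone"
        using closed_cone _ lim(2) by (rule closed_sequentially) (use x(1) slit_cone_iff in blast)
      ultimately have l2: "Im l2 = 0" "1 \<le> Re l2"
        using slit_cone_iff[of l2] by (auto simp: slit_cone_def)
      \<comment> \<open>Half the gap between \<rho> M, the limiting lower bound for the normal
        component near the slit, and r M, its upper bound for values of modulus at most r.\<close>
      define \<epsilon> where "\<epsilon> = (\<rho> - r) * M / 2"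
      have "\<epsilon> > 0" using r M by (simp add: \<epsilon>_def)
      then obtain a \<eta> where a: "0 < a" "a < 1" "0 < \<eta>"
        "\<And>z. z \<in> slit_cone \<Longrightarrow> a \<le> Re z \<Longrightarrow> Im z < \<eta> \<Longrightarrow>
          phi n k * sin (p * pi) - \<epsilon> \<le> Re (cis (pi / 2 - p * pi) * F z)"
        using F_ge_near_slit by blast
      have "\<forall>\<^sub>F i in sequentially. a < Re (x (\<sigma> i))"
        using tendsto_Re[OF lim(2)] by (rule order_tendstoD) (use l2 a in auto)
      moreover have "\<forall>\<^sub>F i in sequentially. Im (x (\<sigma> i)) < \<eta>"
        using tendsto_Im[OF lim(2)] by (rule order_tendstoD) (use l2 a in auto)
      ultimately have "\<forall>\<^sub>F i in sequentially. a < Re (x (\<sigma> i)) \<and> Im (x (\<sigma> i)) < \<eta>"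
        by (rule eventually_conj)
      from eventually_happens'[OF sequentially_bot this]
      obtain i where i: "a < Re (x (\<sigma> i))" "Im (x (\<sigma> i)) < \<eta>" by blast
      have "\<rho> * M - \<epsilon> \<le> Re (cis (pi / 2 - p * pi) * F (x (\<sigma> i)))"
        unfolding \<rho> using i by (intro a(4) x) auto
      also have "\<dots> \<le> norm (F (x (\<sigma> i))) * M"
        using F_in_cone[OF x(1)] M(2) by (rule Re_le_norm_cone)
      also have "\<dots> \<le> r * M"
        using N[of "\<sigma> i"] M(1) x(3) z(2) by (intro mult_right_mono) (auto simp: \<sigma>_def less_imp_le)
      finally have "(\<rho> - r) * M \<le> \<epsilon>" by (simp add: algebra_simps)
      with \<open>\<epsilon> > 0\<close> have False unfolding \<epsilon>_def by linarith
      then show ?thesis ..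
    qed
  qed
  \<comment> \<open>The covered part of the disc is open, relatively closed and contains 0, so by
    connectedness it is the whole disc.\<close>
  let ?T = "ball 0 \<rho> \<inter> F ` D"
  have "openin (top_of_set (ball 0 \<rho>)) ?T" using open_img by (rule openin_open_Int)
  moreover have "?T = ball 0 \<rho> \<inter> closure (F ` D)"
    using sub closure_subset[of "F ` D"] by auto
  then have "closedin (top_of_set (ball 0 \<rho>)) ?T" by (metis closed_closure closedin_closed_Int)
  ultimately have "?T = {} \<or> ?T = ball 0 \<rho>"
    using connected_ball[of "0::complex" \<rho>] unfolding connected_clopen by blast
  moreover have "0 \<in> F ` D" using F_0 zero_in_D by (metis imageI)
  then have "0 \<in> ?T" if "ball (0::complex) \<rho> \<noteq> {}"
    using that by (intro IntI) auto
  ultimately show ?thesis by blast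
qed

section \<open>The Maclaurin series and the inverse of \<open>F\<close>\<close>

lemma ball_subset_D: "ball 0 1 \<subseteq> D"
proof
  fix z :: complex assume "z \<in> ball 0 1"
  then have "norm (z ^ n) < 1" using n_pos by (simp add: norm_power power_less_one_iff)
  then show "z \<in> D" using complex_Re_le_cmod[of "z ^ n"] by (simp add: in_D_iff)
qed

lemma norm_F_of_real:
  assumes "0 \<le> x" "x < 1"
  shows "norm (F (of_real x)) < phi n k"
  using E_strict_mono[of x 1] E_strict_mono[of 0 x] assms
  by (cases "x = 0") (auto simp: F_of_real phi_eq_E)

lemma S_real_eq:
  assumes "0 \<le> y" "y \<le> 1"
  shows "S_real n k (E y) = y"
proof -
  have "inj_on (F_real n k) {0..1}"
  proof (rule linorder_inj_onI)
    fix x y :: real assume "x < y" "x \<in> {0..1}" "y \<in> {0..1}"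
    then show "F_real n k x \<noteq> F_real n k y" using E_strict_mono[of x y] by (simp add: F_real_eq_E)
  qed auto
  then show ?thesis
    unfolding S_real_def using assms by (intro the_inv_into_f_eq) (auto simp: F_real_eq_E)
qed

text \<open>\<open>S_extension\<close> is an arbitrary choice. The global inverse of
  \<open>F\<close> witnesses that an extension exists, and any chosen one inverts \<open>F\<close>
  within the unit disc, so it has the same germ at 0.\<close>

lemma maclaurin_inverse:
  obtains S where "S holomorphic_on F ` D" "\<And>z. z \<in> D \<Longrightarrow> S (F z) = z"
    "maclaurin_S n k = fps_expansion S 0"
proof -
  obtain S where S: "S holomorphic_on F ` D" "\<And>z. z \<in> D \<Longrightarrow> S (F z) = z"
    using holomorphic_has_inverse[OF holomorphic_F open_D inj_on_F] by metis
  \<comment> \<open>The bound on \<open>F z\<close> keeps the endpoint \<open>phi n k\<close> out of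
    \<open>V\<close>: the real points of \<open>V\<close> to be checked then come from y < 1, where
    \<open>F_of_real\<close> applies.\<close>
  define U where "U = {z \<in> ball 0 1. F z \<in> ball 0 (phi n k)}"
  define V where "V = F ` U"
  have UD: "U \<subseteq> D" using ball_subset_D by (auto simp: U_def)
  have "open ((F -` ball 0 (phi n k)) \<inter> ball 0 1)"
    by (rule continuous_on_open_vimage[THEN iffD1, rule_format, OF open_ball])
       (auto intro: continuous_on_subset[OF continuous_on_F ball_subset_D])
  moreover have "(F -` ball 0 (phi n k)) \<inter> ball 0 1 = U" by (auto simp: U_def)
  ultimately have oU: "open U" by simp
  have oV: "open V"
    unfolding V_def
    by (rule open_mapping_thm3[OF _ oU])
       (use UD holomorphic_F inj_on_F in \<open>auto intro: holomorphic_on_subset inj_on_subset\<close>)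
  have U0: "0 \<in> U" using phi_pos by (simp add: U_def)
  then have V0: "0 \<in> V" unfolding V_def using F_0 by (metis imageI)
  have VD: "V \<subseteq> F ` D" using UD by (auto simp: V_def)
  have "is_S_extension n k S"
    unfolding is_S_extension_def
  proof (intro exI conjI ballI impI)
    show "S holomorphic_on V" using S(1) VD by (rule holomorphic_on_subset)
    then have "continuous_on V S" by (rule holomorphic_on_imp_continuous_on)
    then show "homeomorphism U V F S"
      unfolding homeomorphism_def using S(2) UD continuous_on_subset[OF continuous_on_F UD]
      by (auto simp: V_def image_image image_iff subset_iff)
    fix x assume x: "x \<in> {0..phi n k}" "complex_of_real x \<in> V"
    from x(2) obtain u where u: "complex_of_real x = F u" "norm (F u) < phi n k"
      by (auto simp: V_def U_def)
    have "norm (complex_of_real x) < phi n k" unfolding u(1) by (rule u(2))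
    with x(1) have "x < phi n k" by simp
    with x obtain y where y: "0 \<le> y" "y \<le> 1" "E y = x"
      using IVT'[of E 0 x 1] continuous_on_E by (auto simp: phi_eq_E)
    with \<open>x < phi n k\<close> have "y < 1" by (cases "y = 1") (auto simp: phi_eq_E)
    with y have "F (of_real y) = of_real x" by (simp add: F_of_real)
    then have "S (of_real x) = of_real y"
      using S(2)[OF of_real_in_D[OF y(1) \<open>y < 1\<close>]] by simp
    then show "S (complex_of_real x) = complex_of_real (S_real n k x)"
      using S_real_eq[OF y(1,2)] y(3) by simp
  qed (use oU oV U0 V0 in \<open>auto simp: U_def\<close>)
  then have "is_S_extension n k (S_extension n k)"
    unfolding S_extension_def by (rule someI[where P = "is_S_extension n k"])
  then obtain U' V' where UV: "U' \<subseteq> ball 0 1" "open V'" "0 \<in> V'"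
    "homeomorphism U' V' F (S_extension n k)"
    unfolding is_S_extension_def by blast
  have "S_extension n k w = S w" if "w \<in> V'" for w
  proof -
    have "S_extension n k w \<in> U'" "F (S_extension n k w) = w"
      using UV(4) that by (auto simp: homeomorphism_def)
    then show ?thesis using S(2)[of "S_extension n k w"] UV(1) ball_subset_D by auto
  qed
  then have "\<forall>\<^sub>F w in nhds 0. S_extension n k w = S w"
    using UV by (auto simp: eventually_nhds)
  then have "maclaurin_S n k = fps_expansion S 0"
    unfolding maclaurin_S_def by (rule fps_expansion_cong)
  with S that show ?thesis by blast
qed

lemma R_conv_ge:
  assumes "ball 0 \<rho> \<subseteq> F ` D"
  shows "ereal \<rho> \<le> R_conv n k"
proof -
  obtain S where S: "S holomorphic_on F ` D" "maclaurin_S n k = fps_expansion S 0"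
    using maclaurin_inverse by metis
  have "S holomorphic_on eball 0 (ereal \<rho>)"
    using S(1) assms by (auto intro: holomorphic_on_subset)
  then show ?thesis unfolding R_conv_def S(2) by (rule conv_radius_fps_expansion)
qed

text \<open>The disc of convergence is not known to lie in the image of \<open>D\<close>, so the
  inverse relation is continued instead on the z side: it holds near 0 and spreads by the identity
  theorem over the component of 0 in the part of \<open>D\<close> that \<open>F\<close> sends into
  that disc.\<close>

lemma eval_maclaurin_F:
  assumes "connected L" "0 \<in> L" "L \<subseteq> D" "\<And>z. z \<in> L \<Longrightarrow> ereal (norm (F z)) < R_conv n k"
  obtains C where "open C" "L \<subseteq> C" "C \<subseteq> D" "\<forall>z\<in>C. ereal (norm (F z)) < R_conv n k"
    "\<forall>z\<in>C. eval_fps (maclaurin_S n k) (F z) = z"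
proof -
  let ?f = "eval_fps (maclaurin_S n k)"
  let ?B = "eball (0::complex) (R_conv n k)"
  obtain S where S: "S holomorphic_on F ` D" "\<And>z. z \<in> D \<Longrightarrow> S (F z) = z"
    "maclaurin_S n k = fps_expansion S 0" using maclaurin_inverse by blast
  have "open (F ` D)" using holomorphic_F open_D inj_on_F by (rule open_mapping_thm3)
  moreover have "0 \<in> F ` D" using F_0 zero_in_D by (metis imageI)
  ultimately have "S has_fps_expansion maclaurin_S n k"
    unfolding S(3) using S(1) by (rule has_fps_expansion_fps_expansion)
  then have near: "\<forall>\<^sub>F w in nhds 0. ?f w = S w" by (simp add: has_fps_expansion_def)
  define A where "A = (F -` ?B) \<inter> D"
  have oA: "open A"
    unfolding A_def
    by (rule continuous_on_open_vimage[THEN iffD1, rule_format]) (auto intro: open_D continuous_on_F)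
  have LA: "L \<subseteq> A" using assms by (auto simp: A_def)
  define C where "C = connected_component_set A 0"
  have C: "open C" "connected C" "C \<subseteq> A" "L \<subseteq> C"
    unfolding C_def
    by (rule open_connected_component[OF oA] connected_connected_component
        connected_component_subset connected_component_maximal[OF assms(2,1) LA])+
  have C0: "0 \<in> C" using C assms by blast
  have "?f holomorphic_on ?B" by (rule holomorphic_on_eval_fps) (simp add: R_conv_def)
  then have hol: "(?f \<circ> F) holomorphic_on C"
    using holomorphic_F C(3)
    by (intro holomorphic_on_compose_gen[of F C ?f ?B]) (auto intro: holomorphic_on_subset simp: A_def)
  have "F \<midarrow>0\<rightarrow> 0" using DERIV_isCont[OF F_deriv[OF zero_in_D]] by (simp add: isCont_def)
  then have "filterlim F (nhds 0) (nhds 0)" by (simp add: tendsto_nhds_iff)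
  from eventually_compose_filterlim[OF near this]
  have "\<forall>\<^sub>F z in nhds 0. ?f (F z) = S (F z)" .
  then obtain W where W: "open W" "0 \<in> W" "\<And>z. z \<in> W \<Longrightarrow> ?f (F z) = S (F z)"
    by (auto simp: eventually_nhds)
  have "?f (F z) = z" if "z \<in> C" for z
  proof -
    have "(?f \<circ> F) z = (\<lambda>z. z) z"
    proof (rule analytic_continuation_open[of "W \<inter> C" C])
      show "(?f \<circ> F) u = u" if "u \<in> W \<inter> C" for u
        using that W(3)[of u] S(2)[of u] C(3) by (auto simp: A_def)
      show "(?f \<circ> F) holomorphic_on C" by (rule hol)
    qed (use W C C0 that in \<open>auto intro: holomorphic_on_ident\<close>)
    then show ?thesis by simp
  qed
  with C show ?thesis by (intro that[of C]) (auto simp: A_def)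
qed

section \<open>Upper bounds for the radius of convergence\<close>

lemma bounded_on_cball_R_conv:
  assumes "ereal r < R_conv n k" "f holomorphic_on eball 0 (R_conv n k)"
  obtains b where "\<forall>w. norm w \<le> r \<longrightarrow> norm (f w) \<le> b"
proof -
  have "cball 0 r \<subseteq> eball 0 (R_conv n k)"
    by (auto intro!: le_less_trans[OF _ assms(1)])
  then have "continuous_on (cball 0 r) f"
    using assms(2) holomorphic_on_imp_continuous_on continuous_on_subset by blast
  then have "bounded (f ` cball 0 r)"
    using compact_continuous_image compact_cball compact_imp_bounded by blast
  then obtain b where "\<forall>x\<in>cball 0 r. norm (f x) \<le> b" by (auto simp: bounded_iff)
  then show ?thesis by (intro that[of b]) simp
qed

lemma norm_e: "norm e = 1"
  by (simp add: e_def)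

text \<open>If the series converged beyond \<open>T\<close>, its sum would be bounded on the closed
  disc of radius \<open>T\<close>. That disc contains the image of the whole ray through
  \<open>e\<close>, which the sum sends back to the unbounded ray.\<close>

lemma R_conv_le_T:
  assumes "k > 1"
  shows "R_conv n k \<le> ereal T"
proof (rule ccontr)
  assume "\<not> R_conv n k \<le> ereal T"
  then have T: "ereal T < R_conv n k" by simp
  let ?f = "eval_fps (maclaurin_S n k)"
  define L where "L = (\<lambda>a. complex_of_real a * e) ` {0..}"
  have norm_F: "norm (F z) \<le> T" if "z \<in> L" for z
    using that G_le_T[OF assms] G_nonneg by (auto simp: L_def F_ray norm_mult norm_e)
  have "connected L"
    unfolding L_def by (intro connected_continuous_image continuous_intros connected_Ici)
  moreover have "0 \<in> L" unfolding L_def by (rule image_eqI[of _ _ 0]) auto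
  moreover have "L \<subseteq> D" using ray_in_D by (auto simp: L_def)
  moreover have "ereal (norm (F z)) < R_conv n k" if "z \<in> L" for z
    using norm_F[OF that] T by (meson ereal_less_eq(3) le_less_trans)
  ultimately obtain C where C: "open C" "L \<subseteq> C" "C \<subseteq> D" "\<forall>z\<in>C. ereal (norm (F z)) < R_conv n k"
    "\<forall>z\<in>C. ?f (F z) = z"
    by (rule eval_maclaurin_F)
  have "?f holomorphic_on eball 0 (R_conv n k)"
    by (rule holomorphic_on_eval_fps) (simp add: R_conv_def)
  with T obtain b where b: "\<forall>w. norm w \<le> T \<longrightarrow> norm (?f w) \<le> b"
    by (rule bounded_on_cball_R_conv)
  define a where "a = \<bar>b\<bar> + 1"
  have "of_real a * e \<in> L" unfolding L_def by (rule imageI) (simp add: a_def)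
  then have "norm (?f (F (of_real a * e))) \<le> b" "?f (F (of_real a * e)) = of_real a * e"
    using b norm_F C by auto
  then show False by (simp add: norm_mult norm_e a_def)
qed

text \<open>A series converging beyond \<open>\<phi>\<close> would have a bounded second derivative on \<open>[0, \<phi>]\<close>,
  while differentiating \<open>f (F z) = z\<close> twice gives
  \<open>f'' (F x) = - k x\<^sup>n\<^sup>-\<^sup>1 (1 - x\<^sup>n)\<^sup>2\<^sup>p\<^sup>-\<^sup>1\<close>.\<close>

lemma R_conv_le_phi:
  assumes "2 * p < 1"
  shows "R_conv n k \<le> ereal (phi n k)"
proof (rule ccontr)
  assume "\<not> R_conv n k \<le> ereal (phi n k)"
  then have R: "ereal (phi n k) < R_conv n k" by simp
  let ?f = "eval_fps (maclaurin_S n k)"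
  let ?B = "eball (0::complex) (R_conv n k)"
  define L where "L = complex_of_real ` {0..<1}"
  have "connected L"
    unfolding L_def by (intro connected_continuous_image continuous_intros connected_Ico)
  moreover have "0 \<in> L" unfolding L_def by (rule image_eqI[of _ _ 0]) auto
  moreover have "L \<subseteq> D" using of_real_in_D by (auto simp: L_def)
  moreover have "ereal (norm (F z)) < R_conv n k" if "z \<in> L" for z
    using that norm_F_of_real by (auto simp: L_def intro!: less_trans[OF _ R])
  ultimately obtain C where C: "open C" "L \<subseteq> C" "C \<subseteq> D"
    "\<forall>z\<in>C. ereal (norm (F z)) < R_conv n k" "\<forall>z\<in>C. ?f (F z) = z"
    by (rule eval_maclaurin_F)
  have oB: "open ?B" by simp
  have f: "?f holomorphic_on ?B" by (rule holomorphic_on_eval_fps) (simp add: R_conv_def)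
  then have f': "deriv ?f holomorphic_on ?B" using oB by (rule holomorphic_deriv)
  then have f'': "deriv (deriv ?f) holomorphic_on ?B" using oB by (rule holomorphic_deriv)
  have B: "F z \<in> ?B" if "z \<in> C" for z using C(4) that by simp
  have d1: "deriv ?f (F z) * fn z = 1" if z: "z \<in> C" for z
  proof -
    have "((\<lambda>z. ?f (F z)) has_field_derivative deriv ?f (F z) * fn z) (at z)"
      using C(3) z by (intro DERIV_chain2[OF holomorphic_derivI[OF f oB B] F_deriv]) auto
    then have "((\<lambda>z. z) has_field_derivative deriv ?f (F z) * fn z) (at z)"
      by (rule has_field_derivative_transform_within_open[OF _ C(1) z]) (use C(5) in simp)
    then show ?thesis by (rule DERIV_unique[OF _ DERIV_ident])
  qed
  define fn' where "fn' z = (of_real (- p) * (1 - z ^ n) powr (of_real (- p) - 1)) * - (n * z ^ (n - 1))" for z :: complex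
  have d2: "deriv (deriv ?f) (F z) * fn z * fn z + fn' z * deriv ?f (F z) = 0" if z: "z \<in> C" for z
  proof -
    have "((\<lambda>z. deriv ?f (F z) * fn z) has_field_derivative
        deriv (deriv ?f) (F z) * fn z * fn z + fn' z * deriv ?f (F z)) (at z)"
      using C(3) z fn_deriv unfolding fn'_def
      by (intro DERIV_mult DERIV_chain2[OF holomorphic_derivI[OF f' oB B] F_deriv]) auto
    then have "((\<lambda>z. 1) has_field_derivative
        deriv (deriv ?f) (F z) * fn z * fn z + fn' z * deriv ?f (F z)) (at z)"
      by (rule has_field_derivative_transform_within_open[OF _ C(1) z]) (use d1 in simp)
    then show ?thesis by (rule DERIV_unique[OF _ DERIV_const])
  qed
  obtain b where b: "\<forall>w. norm w \<le> phi n k \<longrightarrow> norm (deriv (deriv ?f) w) \<le> b"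
    using R f'' by (rule bounded_on_cball_R_conv)
  have bound: "k * x ^ (n - 1) \<le> b * (1 - x ^ n) powr (1 - 2 * p)" if x: "0 < x" "x < 1" for x :: real
  proof -
    let ?z = "complex_of_real x" and ?u = "1 - x ^ n"
    have u: "0 < ?u" using x n_pos by (simp add: power_less_one_iff)
    have z: "?z \<in> C" using C(2) x by (auto simp: L_def)
    have fn: "fn ?z = of_real (?u powr - p)"
      using powr_of_real[of ?u "- p"] u by (simp add: fn_altdef)
    have "1 - ?z ^ n = of_real ?u" "complex_of_real (- p) - 1 = of_real (- p - 1)" by simp_all
    then have fn': "fn' ?z = of_real (k * x ^ (n - 1) * ?u powr (- p - 1))"
      using powr_of_real[of ?u "- p - 1"] u n_pos by (simp add: fn'_def p_def)
    \<comment> \<open>Multiplying the twice differentiated identity by \<open>fn ?z\<close> allows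
      \<open>d1\<close> to eliminate the first derivative.\<close>
    have "deriv (deriv ?f) (F ?z) * (fn ?z * fn ?z * fn ?z) = - fn' ?z * (deriv ?f (F ?z) * fn ?z)"
      using arg_cong[OF d2[OF z], of "\<lambda>w. w * fn ?z"]
      by (simp add: algebra_simps eq_neg_iff_add_eq_0)
    then have eq: "deriv (deriv ?f) (F ?z) * of_real (?u powr (- 3 * p)) = - fn' ?z"
      unfolding d1[OF z] by (simp add: fn flip: of_real_mult powr_add)
    have "norm (deriv (deriv ?f) (F ?z)) * ?u powr (- 3 * p)
        = norm (deriv (deriv ?f) (F ?z) * of_real (?u powr (- 3 * p)))"
      by (simp only: norm_mult norm_of_real abs_of_nonneg[OF powr_ge_zero])
    also have "\<dots> = k * x ^ (n - 1) * ?u powr (- p - 1)"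
      unfolding eq norm_minus_cancel fn' norm_of_real using x by (intro abs_of_nonneg) simp
    finally have "norm (deriv (deriv ?f) (F ?z)) * ?u powr (- 3 * p) = k * x ^ (n - 1) * ?u powr (- p - 1)" .
    moreover have "norm (deriv (deriv ?f) (F ?z)) \<le> b"
      using norm_F_of_real[of x] x b by simp
    ultimately have "k * x ^ (n - 1) * ?u powr (- p - 1) \<le> b * ?u powr (- 3 * p)"
      using mult_right_mono[of _ b "?u powr (- 3 * p)"] by fastforce
    \<comment> \<open>The exponents are chosen to leave 1 - 2p > 0 on the right, so as x tends to 1
      the right side vanishes while the left side tends to k.\<close>
    then have "k * x ^ (n - 1) * ?u powr (- p - 1) * ?u powr (1 + p) \<le> b * ?u powr (- 3 * p) * ?u powr (1 + p)"
      by (rule mult_right_mono) simp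
    then show ?thesis using u by (simp add: mult.assoc flip: powr_add)
  qed
  have "((\<lambda>x::real. k * x ^ (n - 1)) \<longlongrightarrow> real k * 1 ^ (n - 1)) (at_left 1)"
    by (intro tendsto_intros)
  moreover have "((\<lambda>x::real. b * (1 - x ^ n) powr (1 - 2 * p)) \<longlongrightarrow> b * 0) (at_left 1)"
  proof (intro tendsto_mult tendsto_const)
    have "((\<lambda>x::real. 1 - x ^ n) \<longlongrightarrow> 1 - 1 ^ n) (at_left 1)" by (intro tendsto_intros)
    then have lim: "((\<lambda>x::real. 1 - x ^ n) \<longlongrightarrow> 0) (at_left 1)" by simp
    have "\<forall>\<^sub>F x in at_left (1::real). 0 < x \<and> x < 1" by (rule eventually_at_leftI[of 0]) auto
    then have "\<forall>\<^sub>F x in at_left (1::real). 0 \<le> 1 - x ^ n"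
      by eventually_elim (simp add: power_le_one)
    with assms show "((\<lambda>x::real. (1 - x ^ n) powr (1 - 2 * p)) \<longlongrightarrow> 0) (at_left 1)"
      by (intro tendsto_zero_powrI[OF lim tendsto_const]) auto
  qed
  moreover have "\<forall>\<^sub>F x::real in at_left 1. real k * x ^ (n - 1) \<le> b * (1 - x ^ n) powr (1 - 2 * p)"
    using bound by (intro eventually_at_leftI[of 0]) auto
  ultimately have "real k * 1 ^ (n - 1) \<le> b * 0"
    by (intro tendsto_le[OF trivial_limit_at_left_real])
  then show False using k_ge_1 by simp
qed

section \<open>Lower bounds for the radius of convergence\<close>

text \<open>Here p \<pi> = \<theta>, so sin (p \<pi> - t) is largest at t = 0 and the side opposite
  to 0 has distance \<open>phi n k\<close>. Escape to infinity is excluded by Re \<open>F\<close>,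
  which is at least \<open>G (norm z / 2) * cos \<theta>\<close>.\<close>

lemma R_conv_ge_phi:
  assumes "k = 1"
  shows "ereal (phi n k) \<le> R_conv n k"
proof (rule R_conv_ge, rule ball_subset_image)
  have pt: "p * pi = \<theta>" using \<theta>(4) assms by simp
  show "0 < sin \<theta>" by (rule \<theta>)
  show "phi n k * sin \<theta> = phi n k * sin (p * pi)" by (simp only: pt)
  show "sin (p * pi - t) \<le> sin \<theta>" if "0 \<le> t" "t \<le> \<theta>" for t
    unfolding pt using that \<theta> by (subst sin_mono_le_eq) auto
  fix r
  have "\<forall>\<^sub>F a in at_top. r / cos \<theta> + 1 \<le> G a"
    using G_at_top[OF assms] unfolding filterlim_at_top by blast
  then obtain a where a: "r / cos \<theta> + 1 \<le> G a" by (meson eventually_at_top_linorder order_refl)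
  have "norm z \<le> 2 * a" if z: "z \<in> slit_cone" "norm (F z) \<le> r" for z
  proof (rule ccontr)
    assume "\<not> norm z \<le> 2 * a"
    then have "G a \<le> G (norm z / 2)" by (intro G_mono) simp
    then have "G a * cos \<theta> \<le> G (norm z / 2) * cos (0 + \<theta>)" using \<theta> by simp
    also have "\<dots> \<le> Re (cis 0 * F z)"
    proof (rule F_ge_at_infinity)
      show "0 \<le> cos (0 - \<theta> + \<alpha>)" if "0 \<le> \<alpha>" "\<alpha> < p * pi" for \<alpha>
        using that \<theta> pi_gt_zero unfolding pt by (intro cos_ge_zero; linarith)
    qed (use z \<theta> in auto)
    also have "\<dots> \<le> r" using z complex_Re_le_cmod[of "F z"] by simp
    finally have "G a \<le> r / cos \<theta>" using \<theta> by (simp add: pos_le_divide_eq)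
    with a show False by simp
  qed
  then show "\<exists>b. \<forall>z\<in>slit_cone. norm (F z) \<le> r \<longrightarrow> norm z \<le> b" by blast
qed

text \<open>The same normal component serves near the slits and near infinity. On [s, p \<pi>] sine
  is largest at s, so the nearest point of the side is the image of infinity, at distance
  \<open>T\<close> by the sine rule.\<close>

lemma R_conv_ge_T:
  assumes "real k \<ge> real n / 2 + 1"
  shows "ereal T \<le> R_conv n k"
proof (rule R_conv_ge, rule ball_subset_image)
  define s where "s = (real k - 1) * \<theta>"
  have k: "k > 1" using assms n_gt_2 by linarith
  \<comment> \<open>\<open>s\<close> is the angle of the triangle at the image of infinity; the
    hypothesis on k says that it is at least \<pi>/2.\<close>
  have "(real n / 2) * \<theta> \<le> s" unfolding s_def using assms \<theta> by (intro mult_right_mono) auto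
  then have s: "pi / 2 \<le> s" "p * pi = s + \<theta>" "p * pi < pi"
  proof -
    show "p * pi = s + \<theta>" using \<theta>(4) by (simp add: s_def algebra_simps)
    show "p * pi < pi" using p_less_1 by simp
  qed (use \<theta>(3) in simp)
  have ge: "sin s \<ge> sin y" if "s \<le> y" "y \<le> p * pi" for y
    using sin_mono_le_eq[of "pi - y" "pi - s"] that s by simp
  show M: "0 < sin s" using s \<theta> by (intro sin_gt_zero) auto
  have "T * sin ((real k - 1) * pi / n) = phi n k * sin (real k * pi / n)" using T_phi(1)[OF k] .
  then show "T * sin s = phi n k * sin (p * pi)" by (simp add: s_def \<theta>_def p_def)
  show "sin (p * pi - t) \<le> sin s" if "0 \<le> t" "t \<le> \<theta>" for t
    using that s by (intro ge) auto
  fix r assume "r < T"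
  with G_tendsto_T[OF k] have "\<forall>\<^sub>F a in at_top. r < G a" by (rule order_tendstoD)
  then obtain a where a: "r < G a" by (meson eventually_at_top_linorder order_refl)
  have "norm z \<le> 2 * a" if z: "z \<in> slit_cone" "norm (F z) \<le> r" for z
  proof (rule ccontr)
    assume "\<not> norm z \<le> 2 * a"
    then have "G a \<le> G (norm z / 2)" by (intro G_mono) simp
    moreover have cs: "cos (pi / 2 - p * pi + \<theta>) = sin s"
      unfolding s(2) using sin_cos_eq[of s] cos_minus[of "pi / 2 - s"] by simp
    ultimately have "G a * sin s \<le> G (norm z / 2) * cos (pi / 2 - p * pi + \<theta>)" using M by simp
    also have "\<dots> \<le> Re (cis (pi / 2 - p * pi) * F z)"
    proof (rule F_ge_at_infinity)
      \<comment> \<open>Integrality turns k < n into k + 1 \<le> n, which keeps the step in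
        direction -\<theta> admissible for this normal component.\<close>
      have "p * pi + \<theta> \<le> pi"
        using \<theta>(3,4) k_less_n mult_right_mono[of "real k + 1" "real n" \<theta>] \<theta>(1)
        by (simp add: algebra_simps)
      then show "0 \<le> cos (pi / 2 - p * pi - \<theta> + \<alpha>)" if "0 \<le> \<alpha>" "\<alpha> < p * pi" for \<alpha>
        using that \<theta> by (intro cos_ge_zero; linarith)
    qed (use z M cs in auto)
    also have "\<dots> \<le> norm (F z) * sin s"
      using F_in_cone[OF z(1)] by (rule Re_le_norm_cone) (use s in \<open>auto intro!: ge\<close>)
    also have "\<dots> \<le> r * sin s" using z M by (intro mult_right_mono) auto
    finally show False using a M by simp
  qed
  then show "\<exists>b. \<forall>z\<in>slit_cone. norm (F z) \<le> r \<longrightarrow> norm z \<le> b" by blast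
qed

end

theorem proposition3:
  fixes n k :: nat
  assumes "n > 2" and "1 \<le> k" and "k < n"
  shows "R_conv n 1 = ereal (phi n 1) \<and>
    (k > 1 \<longrightarrow>
      R_conv n k \<le> ereal ((cos (pi / real n) + sin (pi / real n) * cot ((real k - 1) * pi / real n)) * phi n k)) \<and>
    (real k \<ge> real n / 2 + 1 \<longrightarrow>
      R_conv n k = ereal ((cos (pi / real n) + sin (pi / real n) * cot ((real k - 1) * pi / real n)) * phi n k))"
proof -
  \<comment> \<open>The first claim concerns \<open>k = 1\<close> whatever k is given, hence a
    second instance of the locale.\<close>
  interpret one: exponents n 1 using assms by unfold_locales auto
  interpret exponents n k using assms by unfold_locales auto
  have "2 * one.p < 1" unfolding one.p_def using assms by simp
  then have "R_conv n 1 = ereal (phi n 1)"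
    using one.R_conv_le_phi one.R_conv_ge_phi by (simp add: antisym)
  moreover have "real k \<ge> real n / 2 + 1 \<longrightarrow> k > 1" using assms by linarith
  ultimately show ?thesis
    using R_conv_le_T R_conv_ge_T T_phi(2) by (metis antisym)
qed

end
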